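(* Let $X_0=\mathbb{P}^1\times\mathbb{P}^1\times\mathbb{P}^1$ over $\mathbb{Q}$ with coordinate pairs $(a_0:a_1)$, $(b_0:b_1)$, $(c_0:c_1)$, let $l_1=V(a_1,b_1)$, $l_2=V(a_1,c_1)$, and let $\mathfrak{U}=\mathbb{P}^1_\mathbb{Z}\times\mathbb{P}^1_\mathbb{Z}\times\mathbb{P}^1_\mathbb{Z}\setminus\overline{V(a_0)\cup l_1\cup l_2}$. Let $S$ be the set of points $P=((a_0:a_1),(b_0:b_1),(c_0:c_1))\in X_0(\mathbb{Q})$ that can be represented with $a_0,a_1,b_0,b_1,c_0,c_1\in\mathbb{Z}$ all nonzero, $a_0\in\{\pm1\}$, and $\gcd(a_1,b_1)=\gcd(a_1,c_1)=\gcd(b_0,b_1)=\gcd(c_0,c_1)=1$ (these are exactly the points of $\mathfrak{U}(\mathbb{Z})$ lying in the open torus $\{a_0a_1b_0b_1c_0c_1\neq 0\}$). For such $P$ put \[H(P)=\frac{|a_1|}{|a_0|}\max\{|b_0|,|b_1|\}^2\max\{|c_0|,|c_1|\}^2,\] and let $N(B)=\#\{P\in S\mid H(P)\le B\}$. Then \[N(B)=cB(\log B)^2+O\big(B\log B(\log\log B)^3\big),\qquad c=4\prod_p\left(\left(1-\frac1p\right)^2\left(1+\frac2p-\frac1{p^2}-\frac1{p^3}\right)\right),\] the product running over all primes $p$.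
   Context: $H$ is well defined (independent of the choice of integral representatives, which are unique up to signs) and is a log anticanonical height on the toric threefold $X$ obtained from $X_0$ by blowing up $l_1$ and then $l_2$, with boundary $D=E_1+E_2+M$ ($E_i$ the exceptional divisors, $M$ the preimage of $V(a_0)$), whose complement is isomorphic to $X_0\setminus(V(a_0)\cup l_1\cup l_2)$. *)

theory Defs
  imports
    "HOL-Analysis.Infinite_Products"
    "HOL-Computational_Algebra.Primes"
    "HOL-Number_Theory.Cong"
    "HOL-Library.Landau_Symbols"
begin

definition proj_rel :: "rat \<times> rat \<Rightarrow> rat \<times> rat \<Rightarrow> bool" where
  "proj_rel u v \<longleftrightarrow>
     u \<noteq> (0, 0) \<and> v \<noteq> (0, 0) \<and> (\<exists>r. r \<noteq> 0 \<and> v = (r * fst u, r * snd u))"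

lemma part_equivp_proj_rel: "part_equivp proj_rel"
proof (rule part_equivpI)
  show "\<exists>u. proj_rel u u"
    by (rule exI[of _ "(1, 0)"]) (auto simp: proj_rel_def intro: exI[of _ 1])
  show "symp proj_rel"
  proof (rule sympI)
    fix u v assume "proj_rel u v"
    then obtain r where r: "r \<noteq> 0" "v = (r * fst u, r * snd u)"
      and nz: "u \<noteq> (0, 0)" "v \<noteq> (0, 0)"
      unfolding proj_rel_def by blast
    then have "u = (inverse r * fst v, inverse r * snd v)"
      by (simp add: prod_eq_iff)
    with r nz show "proj_rel v u"
      unfolding proj_rel_def by (metis inverse_nonzero_iff_nonzero)
  qed
  show "transp proj_rel"
  proof (rule transpI)
    fix u v w assume "proj_rel u v" "proj_rel v w"
    then obtain r s where "r \<noteq> 0" "v = (r * fst u, r * snd u)"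
      "s \<noteq> 0" "w = (s * fst v, s * snd v)" and nz: "u \<noteq> (0, 0)" "w \<noteq> (0, 0)"
      unfolding proj_rel_def by blast
    then have "s * r \<noteq> 0" "w = (s * r * fst u, s * r * snd u)"
      by (simp_all add: mult.assoc)
    with nz show "proj_rel u w"
      unfolding proj_rel_def by blast
  qed
qed

text \<open>The rational points of the projective line.\<close>

quotient_type p1 = "rat \<times> rat" / partial: proj_rel
  by (rule part_equivp_proj_rel)

type_synonym x0 = "p1 \<times> p1 \<times> p1"

text \<open>\<open>homog P x y\<close> says \<open>P = (x : y)\<close>; in particular it entails \<open>(x, y) \<noteq> (0, 0)\<close>.\<close>

lift_definition homog :: "p1 \<Rightarrow> rat \<Rightarrow> rat \<Rightarrow> bool" is "\<lambda>u x y. proj_rel u (x, y)"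
  using part_equivp_proj_rel unfolding part_equivp_def by (intro ext) metis

lemma homog_abs_p1:
  assumes "x \<noteq> 0 \<or> y \<noteq> 0"
  shows "homog (abs_p1 (x, y)) x y"
proof -
  have "proj_rel (x, y) (x, y)"
    using assms by (auto simp: proj_rel_def intro: exI[of _ 1])
  then show ?thesis
    by (simp add: homog.abs_eq)
qed

lemma homog_unique: "homog P x y \<Longrightarrow> homog Q x y \<Longrightarrow> P = Q"
  by transfer (meson part_equivp_proj_rel part_equivp_symp part_equivp_transp)

definition repr ::
  "x0 \<Rightarrow> int \<Rightarrow> int \<Rightarrow> int \<Rightarrow> int \<Rightarrow> int \<Rightarrow> int \<Rightarrow> bool" where
  "repr P a\<^sub>0 a\<^sub>1 b\<^sub>0 b\<^sub>1 c\<^sub>0 c\<^sub>1 \<longleftrightarrow>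
     homog (fst P) (of_int a\<^sub>0) (of_int a\<^sub>1) \<and>
     homog (fst (snd P)) (of_int b\<^sub>0) (of_int b\<^sub>1) \<and>
     homog (snd (snd P)) (of_int c\<^sub>0) (of_int c\<^sub>1)"

definition torus :: "x0 set" where
  "torus = {P. \<exists>a\<^sub>0 a\<^sub>1 b\<^sub>0 b\<^sub>1 c\<^sub>0 c\<^sub>1.
     homog (fst P) a\<^sub>0 a\<^sub>1 \<and> homog (fst (snd P)) b\<^sub>0 b\<^sub>1 \<and> homog (snd (snd P)) c\<^sub>0 c\<^sub>1 \<and>
     a\<^sub>0 * a\<^sub>1 * b\<^sub>0 * b\<^sub>1 * c\<^sub>0 * c\<^sub>1 \<noteq> 0}"

text \<open>
  The closure of \<open>V(a\<^sub>0) \<union> l\<^sub>1 \<union> l\<^sub>2\<close> in the product of three projective lines over the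
  integers is \<open>V(a\<^sub>0) \<union> V(a\<^sub>1, b\<^sub>1) \<union> V(a\<^sub>1, c\<^sub>1)\<close>. The predicate describes its fibre over
  the point \<open>(p)\<close> of \<open>Spec \<int>\<close>, where \<open>p\<close> is a prime or 0; congruence modulo 0 is
  equality, so \<open>p = 0\<close> gives the generic fibre.
\<close>

definition boundary_fibre ::
  "int \<Rightarrow> int \<Rightarrow> int \<Rightarrow> int \<Rightarrow> int \<Rightarrow> int \<Rightarrow> int \<Rightarrow> bool" where
  "boundary_fibre p a\<^sub>0 a\<^sub>1 b\<^sub>0 b\<^sub>1 c\<^sub>0 c\<^sub>1 \<longleftrightarrow>
     [a\<^sub>0 = 0] (mod p) \<or>
     [a\<^sub>1 = 0] (mod p) \<and> [b\<^sub>1 = 0] (mod p) \<or>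
     [a\<^sub>1 = 0] (mod p) \<and> [c\<^sub>1 = 0] (mod p)"

text \<open>
  The set \<open>\<UU>(\<int>)\<close>, as a subset of the rational points. A rational point extends uniquely to
  a section over \<open>Spec \<int>\<close>, whose value at \<open>(p)\<close> is the reduction modulo \<open>p\<close> of primitive
  integral coordinates; it is a point of \<open>\<UU>(\<int>)\<close> iff that section avoids the closed set.
\<close>

definition U_integral :: "x0 set" where
  "U_integral = {P. \<exists>a\<^sub>0 a\<^sub>1 b\<^sub>0 b\<^sub>1 c\<^sub>0 c\<^sub>1.
     repr P a\<^sub>0 a\<^sub>1 b\<^sub>0 b\<^sub>1 c\<^sub>0 c\<^sub>1 \<and> coprime a\<^sub>0 a\<^sub>1 \<and> coprime b\<^sub>0 b\<^sub>1 \<and> coprime c\<^sub>0 c\<^sub>1 \<and>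
     (\<forall>p. p = 0 \<or> prime p \<longrightarrow> \<not> boundary_fibre p a\<^sub>0 a\<^sub>1 b\<^sub>0 b\<^sub>1 c\<^sub>0 c\<^sub>1)}"

definition S_repr ::
  "x0 \<Rightarrow> int \<Rightarrow> int \<Rightarrow> int \<Rightarrow> int \<Rightarrow> int \<Rightarrow> int \<Rightarrow> bool" where
  "S_repr P a\<^sub>0 a\<^sub>1 b\<^sub>0 b\<^sub>1 c\<^sub>0 c\<^sub>1 \<longleftrightarrow>
     repr P a\<^sub>0 a\<^sub>1 b\<^sub>0 b\<^sub>1 c\<^sub>0 c\<^sub>1 \<and>
     a\<^sub>0 \<noteq> 0 \<and> a\<^sub>1 \<noteq> 0 \<and> b\<^sub>0 \<noteq> 0 \<and> b\<^sub>1 \<noteq> 0 \<and> c\<^sub>0 \<noteq> 0 \<and> c\<^sub>1 \<noteq> 0 \<and>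
     a\<^sub>0 \<in> {1, -1} \<and>
     gcd a\<^sub>1 b\<^sub>1 = 1 \<and> gcd a\<^sub>1 c\<^sub>1 = 1 \<and> gcd b\<^sub>0 b\<^sub>1 = 1 \<and> gcd c\<^sub>0 c\<^sub>1 = 1"

definition S_points :: "x0 set" where
  "S_points = {P. \<exists>a\<^sub>0 a\<^sub>1 b\<^sub>0 b\<^sub>1 c\<^sub>0 c\<^sub>1. S_repr P a\<^sub>0 a\<^sub>1 b\<^sub>0 b\<^sub>1 c\<^sub>0 c\<^sub>1}"

definition height_formula :: "int \<Rightarrow> int \<Rightarrow> int \<Rightarrow> int \<Rightarrow> int \<Rightarrow> int \<Rightarrow> real" where
  "height_formula a\<^sub>0 a\<^sub>1 b\<^sub>0 b\<^sub>1 c\<^sub>0 c\<^sub>1 =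
     \<bar>real_of_int a\<^sub>1\<bar> / \<bar>real_of_int a\<^sub>0\<bar> *
     (max \<bar>real_of_int b\<^sub>0\<bar> \<bar>real_of_int b\<^sub>1\<bar>)\<^sup>2 *
     (max \<bar>real_of_int c\<^sub>0\<bar> \<bar>real_of_int c\<^sub>1\<bar>)\<^sup>2"

text \<open>Only meaningful on \<open>S_points\<close>, where \<open>height_eq\<close> below shows that it is well defined.\<close>

definition height :: "x0 \<Rightarrow> real" where
  "height P = (THE h. \<exists>a\<^sub>0 a\<^sub>1 b\<^sub>0 b\<^sub>1 c\<^sub>0 c\<^sub>1.
     S_repr P a\<^sub>0 a\<^sub>1 b\<^sub>0 b\<^sub>1 c\<^sub>0 c\<^sub>1 \<and> h = height_formula a\<^sub>0 a\<^sub>1 b\<^sub>0 b\<^sub>1 c\<^sub>0 c\<^sub>1)"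

definition N_count :: "real \<Rightarrow> nat" where
  "N_count B = card {P \<in> S_points. height P \<le> B}"

definition euler_factor :: "nat \<Rightarrow> real" where
  "euler_factor p =
     (1 - 1 / real p)\<^sup>2 * (1 + 2 / real p - 1 / real p ^ 2 - 1 / real p ^ 3)"


lemma homog_primitive_unique:
  assumes "homog P (of_int x) (of_int y)" "homog P (of_int x') (of_int y')"
    and "coprime x y" "coprime x' y'"
  shows "\<bar>x'\<bar> = \<bar>x\<bar> \<and> \<bar>y'\<bar> = \<bar>y\<bar>"
proof -
  have "proj_rel (of_int x, of_int y) (of_int x', of_int y')"
    using assms(1,2) part_equivp_proj_rel
    by transfer (meson part_equivp_symp part_equivp_transp)
  then obtain r :: rat where r: "of_int x' = r * of_int x" "of_int y' = r * of_int y"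
    by (auto simp: proj_rel_def)
  then have "of_int (x' * y) = (of_int (y' * x) :: rat)"
    by simp
  then have eq: "x' * y = y' * x"
    by (simp only: of_int_eq_iff)
  have "x dvd x'" "y dvd y'"
    using eq assms(3) by (metis coprime_dvd_mult_left_iff dvd_triv_right,
        metis coprime_commute coprime_dvd_mult_left_iff dvd_triv_right)
  moreover have "x' dvd x" "y' dvd y"
    using eq assms(4) by (metis coprime_dvd_mult_right_iff dvd_triv_left,
        metis coprime_commute coprime_dvd_mult_right_iff dvd_triv_left)
  ultimately show ?thesis
    by (meson zdvd_antisym_abs)
qed

lemma S_repr_unique:
  assumes "S_repr P a\<^sub>0 a\<^sub>1 b\<^sub>0 b\<^sub>1 c\<^sub>0 c\<^sub>1" "S_repr P a\<^sub>0' a\<^sub>1' b\<^sub>0' b\<^sub>1' c\<^sub>0' c\<^sub>1'"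
  shows "\<bar>a\<^sub>0'\<bar> = \<bar>a\<^sub>0\<bar> \<and> \<bar>a\<^sub>1'\<bar> = \<bar>a\<^sub>1\<bar> \<and> \<bar>b\<^sub>0'\<bar> = \<bar>b\<^sub>0\<bar> \<and> \<bar>b\<^sub>1'\<bar> = \<bar>b\<^sub>1\<bar> \<and>
    \<bar>c\<^sub>0'\<bar> = \<bar>c\<^sub>0\<bar> \<and> \<bar>c\<^sub>1'\<bar> = \<bar>c\<^sub>1\<bar>"
proof -
  have "coprime a\<^sub>0 a\<^sub>1" "coprime a\<^sub>0' a\<^sub>1'"
    using assms by (auto simp: S_repr_def)
  then show ?thesis
    using assms homog_primitive_unique unfolding S_repr_def repr_def coprime_iff_gcd_eq_1
    by meson
qed

lemma height_eq:
  assumes "S_repr P a\<^sub>0 a\<^sub>1 b\<^sub>0 b\<^sub>1 c\<^sub>0 c\<^sub>1"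
  shows "height P = height_formula a\<^sub>0 a\<^sub>1 b\<^sub>0 b\<^sub>1 c\<^sub>0 c\<^sub>1"
  unfolding height_def
proof (rule the_equality)
  show "\<exists>a\<^sub>0' a\<^sub>1' b\<^sub>0' b\<^sub>1' c\<^sub>0' c\<^sub>1'. S_repr P a\<^sub>0' a\<^sub>1' b\<^sub>0' b\<^sub>1' c\<^sub>0' c\<^sub>1' \<and>
      height_formula a\<^sub>0 a\<^sub>1 b\<^sub>0 b\<^sub>1 c\<^sub>0 c\<^sub>1 = height_formula a\<^sub>0' a\<^sub>1' b\<^sub>0' b\<^sub>1' c\<^sub>0' c\<^sub>1'"
    using assms by blast
next
  fix h assume "\<exists>a\<^sub>0' a\<^sub>1' b\<^sub>0' b\<^sub>1' c\<^sub>0' c\<^sub>1'. S_repr P a\<^sub>0' a\<^sub>1' b\<^sub>0' b\<^sub>1' c\<^sub>0' c\<^sub>1' \<and>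
      h = height_formula a\<^sub>0' a\<^sub>1' b\<^sub>0' b\<^sub>1' c\<^sub>0' c\<^sub>1'"
  then obtain a\<^sub>0' a\<^sub>1' b\<^sub>0' b\<^sub>1' c\<^sub>0' c\<^sub>1' where
    "S_repr P a\<^sub>0' a\<^sub>1' b\<^sub>0' b\<^sub>1' c\<^sub>0' c\<^sub>1'" and h: "h = height_formula a\<^sub>0' a\<^sub>1' b\<^sub>0' b\<^sub>1' c\<^sub>0' c\<^sub>1'"
    by blast
  from S_repr_unique[OF assms this(1)] h
  show "h = height_formula a\<^sub>0 a\<^sub>1 b\<^sub>0 b\<^sub>1 c\<^sub>0 c\<^sub>1"
    by (simp only: height_formula_def flip: of_int_abs)
qed

lemma finite_height_le: "finite {P \<in> S_points. height P \<le> B}"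
proof -
  define I where "I = {- \<lceil>B\<rceil>..\<lceil>B\<rceil>}"
  define pt where "pt = (\<lambda>(x::int, y::int). THE P. homog P (of_int x) (of_int y))"
  have pt: "pt (x, y) = P" if "homog P (of_int x) (of_int y)" for P x y
    unfolding pt_def using that homog_unique by (auto intro!: the_equality)
  have "{P \<in> S_points. height P \<le> B} \<subseteq> (pt ` (I \<times> I)) \<times> (pt ` (I \<times> I)) \<times> (pt ` (I \<times> I))"
  proof
    fix P assume "P \<in> {P \<in> S_points. height P \<le> B}"
    then obtain a\<^sub>0 a\<^sub>1 b\<^sub>0 b\<^sub>1 c\<^sub>0 c\<^sub>1 where r: "S_repr P a\<^sub>0 a\<^sub>1 b\<^sub>0 b\<^sub>1 c\<^sub>0 c\<^sub>1" and "height P \<le> B"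
      by (auto simp: S_points_def)
    define m n where "m = max \<bar>b\<^sub>0\<bar> \<bar>b\<^sub>1\<bar>" and "n = max \<bar>c\<^sub>0\<bar> \<bar>c\<^sub>1\<bar>"
    have pos: "\<bar>a\<^sub>0\<bar> = 1" "\<bar>a\<^sub>1\<bar> \<ge> 1" "m \<ge> 1" "n \<ge> 1"
      using r by (auto simp: S_repr_def m_def n_def)
    have "real_of_int (\<bar>a\<^sub>1\<bar> * m\<^sup>2 * n\<^sup>2) = height P"
      using pos(1) unfolding height_eq[OF r] height_formula_def m_def n_def
      by (simp add: of_int_max flip: of_int_abs)
    then have le: "\<bar>a\<^sub>1\<bar> * m\<^sup>2 * n\<^sup>2 \<le> \<lceil>B\<rceil>"
      using \<open>height P \<le> B\<close> by linarith
    have sq: "m \<le> m\<^sup>2" "n \<le> n\<^sup>2" "1 \<le> m\<^sup>2" "1 \<le> n\<^sup>2"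
      using pos by (auto simp: self_le_power)
    have "\<bar>a\<^sub>1\<bar> * 1 * 1 \<le> \<bar>a\<^sub>1\<bar> * m\<^sup>2 * n\<^sup>2" "1 * m * 1 \<le> \<bar>a\<^sub>1\<bar> * m\<^sup>2 * n\<^sup>2"
      "1 * 1 * n \<le> \<bar>a\<^sub>1\<bar> * m\<^sup>2 * n\<^sup>2"
      using pos sq by (intro mult_mono; simp)+
    then have "\<bar>a\<^sub>1\<bar> \<le> \<lceil>B\<rceil>" "m \<le> \<lceil>B\<rceil>" "n \<le> \<lceil>B\<rceil>"
      using le by linarith+
    then have "{a\<^sub>0, a\<^sub>1, b\<^sub>0, b\<^sub>1, c\<^sub>0, c\<^sub>1} \<subseteq> I"
      using pos unfolding I_def m_def n_def
      by (simp only: insert_subset empty_subsetI atLeastAtMost_iff max.bounded_iff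
          simp_thms; intro conjI; linarith)
    moreover have "fst P = pt (a\<^sub>0, a\<^sub>1)" "fst (snd P) = pt (b\<^sub>0, b\<^sub>1)" "snd (snd P) = pt (c\<^sub>0, c\<^sub>1)"
      using r pt by (auto simp: S_repr_def repr_def)
    ultimately show "P \<in> (pt ` (I \<times> I)) \<times> (pt ` (I \<times> I)) \<times> (pt ` (I \<times> I))"
      by (cases P) auto
  qed
  then show ?thesis
    by (rule finite_subset) (simp add: I_def)
qed

lemma convergent_prod_euler_factor:
  "convergent_prod (\<lambda>p. if prime p then euler_factor p else 1)"
proof -
  have bound: "\<bar>euler_factor p - 1\<bar> \<le> 20 / real p ^ 2" if "p > 0" for p
  proof -
    define x where "x = 1 / real p"
    have x: "0 \<le> x" "x \<le> 1"
      using that by (auto simp: x_def field_simps)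
    have "euler_factor p - 1 = x^2 * (- 4 + 3 * x + x^2 - x^3)"
      unfolding euler_factor_def using that
      by (simp add: x_def field_simps power2_eq_square power3_eq_cube)
    moreover have "x^2 \<le> 1" "x^3 \<le> 1" "0 \<le> x^2" "0 \<le> x^3"
      using x by (auto simp: power_le_one)
    then have "\<bar>- 4 + 3 * x + x^2 - x^3\<bar> \<le> 20"
      using x by linarith
    ultimately have "\<bar>euler_factor p - 1\<bar> \<le> x^2 * 20"
      by (simp add: abs_mult mult_left_mono)
    then show ?thesis
      by (simp add: x_def power_divide)
  qed
  have "summable (\<lambda>p. norm ((if prime p then euler_factor p else 1) - 1 :: real))"
  proof (rule summable_comparison_test)
    show "\<exists>M. \<forall>n\<ge>M. norm (norm ((if prime n then euler_factor n else 1) - 1 :: real))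
        \<le> 20 * inverse (real n ^ 2)"
      using bound by (intro exI[of _ 1]) (auto simp: divide_inverse)
    show "summable (\<lambda>n. 20 * inverse (real n ^ 2))"
      by (intro summable_mult inverse_power_summable) simp
  qed
  then show ?thesis
    by (intro abs_convergent_prod_imp_convergent_prod)
       (simp add: abs_convergent_prod_conv_summable)
qed

end

theory Submission
  imports
    Defs
    "HOL-Analysis.Analysis"
    "HOL-Computational_Algebra.Squarefree"
    "HOL-Real_Asymp.Real_Asymp"
begin

text \<open>
  Up to eight choices of signs, a point is given by positive integers \<open>a\<close>, \<open>b = (b\<^sub>0, b\<^sub>1)\<close> and
  \<open>c = (c\<^sub>0, c\<^sub>1)\<close>, with \<open>b\<close> and \<open>c\<close> coprime pairs of maximum \<open>m\<close> and \<open>n\<close>, and with \<open>a\<close> at most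
  \<open>B / (m n)\<^sup>2\<close> and coprime to \<open>b\<^sub>1 c\<^sub>1\<close>. Summing over \<open>a\<close> gives \<open>B / (m n)\<^sup>2\<close> times the product of
  \<open>1 - 1/p\<close> over the primes \<open>p\<close> dividing \<open>b\<^sub>1 c\<^sub>1\<close>. The error of a sieve by the divisors \<open>d\<close> of
  \<open>b\<^sub>1 c\<^sub>1\<close> is bounded by terms \<open>min 1 (x / d) \<le> (x / d) powr (3/4)\<close>, and these add up to only
  \<open>O(B ln B)\<close> because the sum of \<open>d powr (-3/4)\<close> over the divisors \<open>d\<close> of an integer is bounded on
  average. The main term is summed over \<open>b\<close> and then over \<open>c\<close>: each time a multiplicative weight
  close to 1 at large primes has a mean value given by an Euler product, with a power saving error
  uniform in the weight, and partial summation turns it into a factor \<open>ln B\<close>. The two Euler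
  products multiply to the constant of the theorem, and the total error is \<open>O(B ln B)\<close>.
\<close>

section \<open>Euler products over squarefree numbers\<close>

text \<open>A multiplicative function that depends only on the radical of \<open>n\<close>. Its
  convolution with the Moebius function is \<open>sqfree_prod w\<close>, so sums of
  \<open>rad_prod w\<close> reduce to sums over squarefree \<open>d\<close>.\<close>

definition rad_prod :: "(nat \<Rightarrow> real) \<Rightarrow> nat \<Rightarrow> real" where
  "rad_prod w n = (\<Prod>p\<in>prime_factors n. 1 + w p)"

definition sqfree_prod :: "(nat \<Rightarrow> real) \<Rightarrow> nat \<Rightarrow> real" where
  "sqfree_prod w d = (if squarefree d then \<Prod>p\<in>prime_factors d. w p else 0)"

lemma prod_prime_factors_squarefree:
  fixes d :: nat
  assumes "squarefree d"
  shows "\<Prod>(prime_factors d) = d"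
proof -
  have "d \<noteq> 0" using assms by (metis not_squarefree_0)
  have "(\<Prod>p\<in>prime_factors d. p) = (\<Prod>p\<in>prime_factors d. p ^ multiplicity p d)"
    using assms squarefree_factorial_semiring'[OF \<open>d \<noteq> 0\<close>] by (intro prod.cong) auto
  also have "\<dots> = d"
    using \<open>d \<noteq> 0\<close> by (simp add: prod_prime_factors)
  finally show ?thesis .
qed

lemma squarefree_prod_primes:
  fixes X :: "nat set"
  assumes "finite X" "\<And>p. p \<in> X \<Longrightarrow> prime p"
  shows "squarefree (\<Prod>X)" "prime_factors (\<Prod>X) = X"
proof -
  show "squarefree (\<Prod>X)"
    using assms by (intro squarefree_prod_coprime) (auto intro: primes_coprime squarefree_prime)
  show "prime_factors (\<Prod>X) = X"
    using assms by (subst prime_factors_prod) (auto simp: prime_factorization_prime dest: prime_gt_0_nat)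
qed

text \<open>The product is expanded over the subsets of \<open>A\<close>; a finite set of primes
  corresponds to the squarefree number that is its product, with \<open>prime_factors\<close> as
  inverse.\<close>

lemma prod_one_plus_primes:
  assumes "finite A" "\<And>p. p \<in> A \<Longrightarrow> prime p"
  shows "finite {d. squarefree d \<and> prime_factors d \<subseteq> A}"
    and "(\<Prod>p\<in>A. 1 + w p) = (\<Sum>d | squarefree d \<and> prime_factors d \<subseteq> A. sqfree_prod w d)"
proof -
  have 1: "squarefree (\<Prod>X)" "prime_factors (\<Prod>X) = X" if "X \<subseteq> A" for X
    using that assms by (auto intro!: squarefree_prod_primes intro: finite_subset)
  have bij: "bij_betw (\<lambda>X. \<Prod>X) (Pow A) {d. squarefree d \<and> prime_factors d \<subseteq> A}"
    by (rule bij_betw_byWitness[where f' = prime_factors])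
      (use 1 assms in \<open>auto simp: prod_prime_factors_squarefree intro: finite_subset\<close>)
  show "finite {d. squarefree d \<and> prime_factors d \<subseteq> A}"
    using bij_betw_finite[OF bij] assms by simp
  have "(\<Prod>p\<in>A. 1 + w p) = (\<Prod>p\<in>A. w p + 1)" by (simp add: add.commute)
  also have "\<dots> = (\<Sum>X\<in>Pow A. \<Prod>p\<in>X. w p)"
    using assms by (subst prod_add) auto
  also have "\<dots> = (\<Sum>X\<in>Pow A. sqfree_prod w (\<Prod>X))"
  proof (rule sum.cong[OF refl])
    fix X assume "X \<in> Pow A"
    then have "finite X" "\<And>p. p \<in> X \<Longrightarrow> prime p" using assms finite_subset by auto
    then show "(\<Prod>p\<in>X. w p) = sqfree_prod w (\<Prod>X)"
      by (simp add: sqfree_prod_def squarefree_prod_primes)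
  qed
  also have "\<dots> = (\<Sum>d | squarefree d \<and> prime_factors d \<subseteq> A. sqfree_prod w d)"
    by (rule sum.reindex_bij_betw[OF bij])
  finally show "(\<Prod>p\<in>A. 1 + w p) = (\<Sum>d | squarefree d \<and> prime_factors d \<subseteq> A. sqfree_prod w d)" .
qed

lemma squarefree_dvdI:
  fixes d n :: nat
  assumes d: "squarefree d" "prime_factors d \<subseteq> prime_factors n"
  shows "d dvd n"
proof (rule multiplicity_le_imp_dvd)
  show "d \<noteq> 0" using d by (metis not_squarefree_0)
  fix p :: nat assume "prime p"
  show "multiplicity p d \<le> multiplicity p n"
  proof (cases "p \<in> prime_factors d")
    case True
    then have "multiplicity p d = 1"
      using d \<open>d \<noteq> 0\<close> squarefree_factorial_semiring' by blast
    moreover have "p \<in> prime_factors n" using True d by blast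
    ultimately show ?thesis by (simp add: prime_factors_multiplicity Suc_leI)
  qed (use \<open>prime p\<close> in \<open>simp add: prime_factors_multiplicity\<close>)
qed

text \<open>Expanding the product over the primes of \<open>n\<close> yields the squarefree divisors
  of \<open>n\<close>; all other divisors contribute 0.\<close>

lemma rad_prod_conv_sum_divisors:
  assumes "n > 0"
  shows "rad_prod w n = (\<Sum>d | d dvd n. sqfree_prod w d)"
proof -
  have "rad_prod w n = (\<Sum>d | squarefree d \<and> prime_factors d \<subseteq> prime_factors n. sqfree_prod w d)"
    unfolding rad_prod_def by (rule prod_one_plus_primes(2)) auto
  also have "\<dots> = (\<Sum>d | d dvd n. sqfree_prod w d)"
  proof (rule sum.mono_neutral_left)
    show "finite {d. d dvd n}" using assms by simp
    show "{d. squarefree d \<and> prime_factors d \<subseteq> prime_factors n} \<subseteq> {d. d dvd n}"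
    proof safe
      fix d assume d: "squarefree d" "prime_factors d \<subseteq> prime_factors n"
      then show "d dvd n" by (rule squarefree_dvdI)
    qed
    show "\<forall>d\<in>{d. d dvd n} - {d. squarefree d \<and> prime_factors d \<subseteq> prime_factors n}.
        sqfree_prod w d = 0"
    proof
      fix d
      assume "d \<in> {d. d dvd n} - {d. squarefree d \<and> prime_factors d \<subseteq> prime_factors n}"
      then have "\<not> squarefree d" using assms dvd_prime_factors[of n d] by auto
      then show "sqfree_prod w d = 0" by (simp add: sqfree_prod_def)
    qed
  qed
  finally show ?thesis .
qed

lemma abs_sqfree_prod: "\<bar>sqfree_prod w d\<bar> = sqfree_prod (\<lambda>p. \<bar>w p\<bar>) d"
  by (simp add: sqfree_prod_def abs_prod)

lemma prod_one_plus_le_exp: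
  assumes "finite A" "summable w" "\<And>p. w p \<ge> 0"
  shows "(\<Prod>p\<in>A. 1 + w p) \<le> exp (\<Sum>p. w p :: real)"
proof -
  have "(\<Prod>p\<in>A. 1 + w p) \<le> (\<Prod>p\<in>A. exp (w p))"
    using assms by (intro prod_mono) (auto simp: add_nonneg_nonneg)
  also have "\<dots> = exp (\<Sum>p\<in>A. w p)" using assms by (simp add: exp_sum)
  also have "\<dots> \<le> exp (\<Sum>p. w p)" using assms by (simp add: sum_le_suminf)
  finally show ?thesis .
qed

text \<open>The partial Euler product up to \<open>N\<close> is the sum over the squarefree numbers
  whose primes are at most \<open>N\<close>. These include all squarefree numbers up to
  \<open>N\<close>, so the exponential bound on finite products gives absolute convergence, and from
  it the limit.\<close>

lemma euler_product_sqfree: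
  assumes "summable (\<lambda>p. \<bar>w p\<bar>)"
  shows summable_abs_sqfree_prod: "summable (\<lambda>d. \<bar>sqfree_prod w d\<bar>)"
    and suminf_abs_sqfree_prod_le: "(\<Sum>d. \<bar>sqfree_prod w d\<bar>) \<le> exp (\<Sum>p. \<bar>w p\<bar>)"
    and LIMSEQ_euler_product:
      "(\<lambda>N. \<Prod>p | prime p \<and> p \<le> N. 1 + w p) \<longlonglongrightarrow> (\<Sum>d. sqfree_prod w d)"
proof -
  define Q where "Q = (\<lambda>N. {d::nat. squarefree d \<and> prime_factors d \<subseteq> {p. prime p \<and> p \<le> N}})"
  have finQ: "finite (Q N)" for N
    unfolding Q_def by (rule prod_one_plus_primes) auto
  have prodQ: "(\<Prod>p | prime p \<and> p \<le> N. 1 + v p) = (\<Sum>d\<in>Q N. sqfree_prod v d)" for N v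
    unfolding Q_def by (rule prod_one_plus_primes) auto
  have subQ: "d \<in> Q N" if "squarefree d" "d \<le> N" for d N
  proof -
    have "d > 0" using that by (metis not_squarefree_0 gr0I)
    then show ?thesis using that by (auto simp: Q_def in_prime_factors_iff dest!: dvd_imp_le)
  qed
  have le: "(\<Sum>d\<le>N. \<bar>sqfree_prod w d\<bar>) \<le> (\<Sum>d\<in>Q N. \<bar>sqfree_prod w d\<bar>)" for N
  proof -
    have "(\<Sum>d\<le>N. \<bar>sqfree_prod w d\<bar>) = (\<Sum>d | d \<le> N \<and> squarefree d. \<bar>sqfree_prod w d\<bar>)"
      by (rule sum.mono_neutral_right) (auto simp: sqfree_prod_def)
    also have "\<dots> \<le> (\<Sum>d\<in>Q N. \<bar>sqfree_prod w d\<bar>)"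
      by (rule sum_mono2) (use finQ subQ in auto)
    finally show ?thesis .
  qed
  have Qle: "(\<Sum>d\<in>Q N. \<bar>sqfree_prod w d\<bar>) \<le> exp (\<Sum>p. \<bar>w p\<bar>)" for N
    unfolding abs_sqfree_prod prodQ[symmetric] using assms
    by (intro prod_one_plus_le_exp) auto
  have bnd: "(\<Sum>d<N. \<bar>sqfree_prod w d\<bar>) \<le> exp (\<Sum>p. \<bar>w p\<bar>)" for N
    using le[of N] Qle[of N] sum_mono2[of "{..N}" "{..<N}" "\<lambda>d. \<bar>sqfree_prod w d\<bar>"]
    by (auto simp: subset_iff)
  show s: "summable (\<lambda>d. \<bar>sqfree_prod w d\<bar>)"
    by (rule summableI_nonneg_bounded[OF _ bnd]) auto
  show "(\<Sum>d. \<bar>sqfree_prod w d\<bar>) \<le> exp (\<Sum>p. \<bar>w p\<bar>)"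
    by (rule suminf_le_const[OF s bnd])
  have hs: "(sqfree_prod w has_sum (\<Sum>d. sqfree_prod w d)) {d. squarefree d}"
  proof -
    have "(sqfree_prod w has_sum (\<Sum>d. sqfree_prod w d)) UNIV"
      using s by (intro norm_summable_imp_has_sum) (auto intro: summable_sums summable_rabs_cancel)
    then show ?thesis
      by (rule has_sum_cong_neutral[THEN iffD1, rotated -1]) (auto simp: sqfree_prod_def)
  qed
  \<comment> \<open>The sets \<open>Q N\<close> are in general not initial segments, hence the
    passage through unordered summation: they eventually contain any given finite set of squarefree
    numbers.\<close>
  have "filterlim Q (finite_subsets_at_top {d. squarefree d}) sequentially"
    unfolding filterlim_finite_subsets_at_top
  proof safe
    fix X assume X: "finite X" "X \<subseteq> {d::nat. squarefree d}"
    show "\<forall>\<^sub>F N in sequentially. finite (Q N) \<and> X \<subseteq> Q N \<and> Q N \<subseteq> {d. squarefree d}"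
      using eventually_ge_at_top[of "Max (insert 0 X)"]
    proof eventually_elim
      case (elim N)
      then have "X \<subseteq> Q N" using X by (auto intro!: subQ)
      moreover have "Q N \<subseteq> {d. squarefree d}" by (auto simp: Q_def)
      ultimately show ?case using finQ by blast
    qed
  qed
  then have "(\<lambda>N. \<Sum>d\<in>Q N. sqfree_prod w d) \<longlonglongrightarrow> (\<Sum>d. sqfree_prod w d)"
    using hs unfolding has_sum_def by (rule filterlim_compose[rotated])
  then show "(\<lambda>N. \<Prod>p | prime p \<and> p \<le> N. 1 + w p) \<longlonglongrightarrow> (\<Sum>d. sqfree_prod w d)"
    by (simp add: prodQ)
qed

text \<open>A nonzero term forces all primes of the squarefree number \<open>d\<close> to divide
  \<open>k\<close>, so the series is the finite sum over the divisors of \<open>k\<close>.\<close>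

lemma suminf_sqfree_prod_finite_support:
  assumes "k > 0" "\<And>p. prime p \<Longrightarrow> p \<notin> prime_factors k \<Longrightarrow> w p = 0"
  shows "(\<Sum>d. sqfree_prod w d) = rad_prod w k"
proof -
  have "sqfree_prod w d = 0" if "\<not> d dvd k" for d
  proof (rule ccontr)
    assume *: "sqfree_prod w d \<noteq> 0"
    then have "squarefree d" by (auto simp: sqfree_prod_def split: if_splits)
    moreover have "prime_factors d \<subseteq> prime_factors k"
      using * assms(2) by (auto simp: sqfree_prod_def split: if_splits)
    ultimately have "d dvd k" by (rule squarefree_dvdI)
    then show False using that by simp
  qed
  then have "(\<Sum>d. sqfree_prod w d) = (\<Sum>d | d dvd k. sqfree_prod w d)"
    using assms(1) by (intro suminf_finite) auto
  then show ?thesis using assms(1) by (simp add: rad_prod_conv_sum_divisors)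
qed

text \<open>This puts the Dirichlet series of \<open>sqfree_prod w\<close> at the real point
  \<sigma> into the form to which the Euler product applies.\<close>

lemma sqfree_prod_divide_powr:
  "sqfree_prod (\<lambda>p. w p / real p powr \<sigma>) d = sqfree_prod w d / real d powr \<sigma>"
proof (cases "squarefree d")
  case True
  have "(\<Prod>p\<in>prime_factors d. real p powr \<sigma>) = (\<Prod>p\<in>prime_factors d. real p) powr \<sigma>"
    by (rule prod_powr_distrib[symmetric])
  also have "(\<Prod>p\<in>prime_factors d. real p) = real d"
    using arg_cong[OF prod_prime_factors_squarefree[OF True], of real] by simp
  finally show ?thesis using True by (simp add: sqfree_prod_def prod_dividef)
qed (simp add: sqfree_prod_def)

lemma sqfree_prod_divide: "sqfree_prod (\<lambda>p. w p / real p) d = sqfree_prod w d / real d"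
  using sqfree_prod_divide_powr[of w 1 d] by simp

lemma sqfree_prod_0 [simp]: "sqfree_prod w 0 = 0"
  by (simp add: sqfree_prod_def)

section \<open>Mean values of functions of the radical\<close>

lemma card_multiples: "d > 0 \<Longrightarrow> card {n\<in>{1..N}. d dvd n} = N div (d::nat)"
proof -
  assume d: "d > 0"
  have "bij_betw (\<lambda>k. d * k) {1..N div d} {n\<in>{1..N}. d dvd n}"
  proof (rule bij_betw_imageI)
    show "inj_on ((*) d) {1..N div d}" using d by (auto simp: inj_on_def)
    show "(*) d ` {1..N div d} = {n \<in> {1..N}. d dvd n}"
      using d by (auto simp: image_iff less_eq_div_iff_mult_less_eq mult.commute dvd_def Suc_le_eq)
  qed
  then show ?thesis using bij_betw_same_card by fastforce
qed

lemma sum_rad_prod_eq: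
  "(\<Sum>n=1..N. rad_prod w n) = (\<Sum>d=1..N. sqfree_prod w d * real (N div d))"
proof -
  have "(\<Sum>n=1..N. rad_prod w n) = (\<Sum>n=1..N. \<Sum>d=1..N. if d dvd n then sqfree_prod w d else 0)"
  proof (rule sum.cong[OF refl])
    fix n assume "n \<in> {1..N}"
    then have n: "0 < n" "n \<le> N" by auto
    have eq: "{d. d dvd n} = {d\<in>{1..N}. d dvd n}"
      using n by (auto dest: dvd_imp_le intro: Suc_leI dvd_pos_nat)
    show "rad_prod w n = (\<Sum>d=1..N. if d dvd n then sqfree_prod w d else 0)"
      unfolding rad_prod_conv_sum_divisors[OF n(1)] eq by (rule sum.inter_filter) simp
  qed
  also have "\<dots> = (\<Sum>d=1..N. \<Sum>n=1..N. if d dvd n then sqfree_prod w d else 0)"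
    by (rule sum.swap)
  also have "\<dots> = (\<Sum>d=1..N. sqfree_prod w d * real (N div d))"
  proof (rule sum.cong[OF refl])
    fix d assume d: "d \<in> {1..N}"
    have "(\<Sum>n=1..N. if d dvd n then sqfree_prod w d else 0) = (\<Sum>n\<in>{n\<in>{1..N}. d dvd n}. sqfree_prod w d)"
      by (subst sum.inter_filter) auto
    then show "(\<Sum>n=1..N. if d dvd n then sqfree_prod w d else 0) = sqfree_prod w d * real (N div d)"
      using d card_multiples[of d N] by simp
  qed
  finally show ?thesis .
qed

text \<open>With \<open>z = x / d\<close> the quotient is the floor of \<open>z\<close>, and the
  error is at most the minimum of 1 and \<open>z\<close>, which lies below
  \<open>z powr \<sigma>\<close> for every exponent between 0 and 1.\<close>

lemma abs_nat_div_minus_le_powr: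
  assumes "x \<ge> 0" "0 \<le> \<sigma>" "\<sigma> \<le> 1" "d > 0"
  shows "\<bar>real (nat \<lfloor>x\<rfloor> div d) - x / real d\<bar> \<le> (x / real d) powr \<sigma>"
proof -
  define z where "z = x / real d"
  have z: "z \<ge> 0" using assms by (simp add: z_def)
  have eq: "real (nat \<lfloor>x\<rfloor> div d) = of_int \<lfloor>z\<rfloor>"
  proof -
    have "\<lfloor>z\<rfloor> = \<lfloor>x\<rfloor> div int d" unfolding z_def
      using floor_divide_real_eq_div[of "int d" x] by simp
    also have "\<dots> = int (nat \<lfloor>x\<rfloor> div d)" using assms by (simp add: zdiv_int)
    finally show ?thesis by simp
  qed
  have "\<bar>of_int \<lfloor>z\<rfloor> - z\<bar> \<le> z powr \<sigma>"
  proof (cases "z \<ge> 1")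
    case True
    then have "1 \<le> z powr \<sigma>" using assms by (simp add: ge_one_powr_ge_zero)
    then show ?thesis by linarith
  next
    case False
    have "z powr 1 \<le> z powr \<sigma>" if "z \<noteq> 0"
      using False assms z that by (intro powr_mono') auto
    then have "z \<le> z powr \<sigma>" using z by (cases "z = 0") auto
    moreover have "\<lfloor>z\<rfloor> = 0" using False z by (simp add: floor_eq_iff)
    ultimately show ?thesis using z by simp
  qed
  then show ?thesis unfolding eq z_def .
qed

text \<open>Interchanging summation over \<open>n\<close> and its divisors leaves
  \<open>sqfree_prod w d\<close> times the floor of \<open>x / d\<close>. The power bound on the
  rounding error holds for all \<open>d\<close>, also beyond \<open>x\<close>, so the main term is
  completed to the full series without a separate tail estimate.\<close>

lemma sum_rad_prod_approx:
  assumes x: "x \<ge> 0" and \<sigma>: "0 \<le> \<sigma>" "\<sigma> \<le> 1"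
    and s: "summable (\<lambda>p. \<bar>w p\<bar> / real p powr \<sigma>)"
  shows "\<bar>(\<Sum>n=1..nat \<lfloor>x\<rfloor>. rad_prod w n) - x * (\<Sum>d. sqfree_prod (\<lambda>p. w p / real p) d)\<bar>
    \<le> x powr \<sigma> * (\<Sum>d. sqfree_prod (\<lambda>p. \<bar>w p\<bar> / real p powr \<sigma>) d)"
proof -
  define g where "g = (\<lambda>d. \<bar>sqfree_prod w d\<bar> / real d powr \<sigma>)"
  have g_eq: "sqfree_prod (\<lambda>p. \<bar>w p\<bar> / real p powr \<sigma>) = g"
    by (rule ext) (simp add: sqfree_prod_divide_powr g_def abs_sqfree_prod)
  have g0: "g d \<ge> 0" for d by (simp add: g_def)
  have sg: "summable g"
    using summable_abs_sqfree_prod[of "\<lambda>p. \<bar>w p\<bar> / real p powr \<sigma>"] s g0 by (simp add: g_eq)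
  have s1: "summable (\<lambda>d. sqfree_prod w d / real d)"
  proof (rule summable_comparison_test'[OF sg])
    fix d :: nat assume "d \<ge> 0"
    show "norm (sqfree_prod w d / real d) \<le> g d"
    proof (cases "d = 0")
      case False
      then have "real d powr \<sigma> \<le> real d powr 1" using \<sigma> by (intro powr_mono) auto
      then show ?thesis using False unfolding g_def by (auto simp: abs_mult intro!: divide_left_mono)
    qed (simp add: g_def)
  qed
  let ?N = "nat \<lfloor>x\<rfloor>"
  \<comment> \<open>The finite sum is read as a series over all \<open>d\<close>: beyond
    \<open>?N\<close> the quotient is 0, and the term at \<open>d = 0\<close> vanishes too.\<close>
  have sums: "(\<lambda>d. sqfree_prod w d * real (?N div d)) sums (\<Sum>n=1..?N. rad_prod w n)"
    unfolding sum_rad_prod_eq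
    by (rule sums_finite) (auto simp: not_le Suc_le_eq)
  have diff: "(\<lambda>d. sqfree_prod w d * real (?N div d) - x * (sqfree_prod w d / real d)) sums
      ((\<Sum>n=1..?N. rad_prod w n) - x * (\<Sum>d. sqfree_prod w d / real d))"
    using sums s1 by (intro sums_diff sums_mult summable_sums)
  have le: "norm (sqfree_prod w d * real (?N div d) - x * (sqfree_prod w d / real d))
      \<le> x powr \<sigma> * g d" for d
  proof (cases "d = 0")
    case False
    have "sqfree_prod w d * real (?N div d) - x * (sqfree_prod w d / real d) =
        sqfree_prod w d * (real (?N div d) - x / real d)" by (simp add: algebra_simps)
    then have "norm (sqfree_prod w d * real (?N div d) - x * (sqfree_prod w d / real d))
        = \<bar>sqfree_prod w d\<bar> * \<bar>real (?N div d) - x / real d\<bar>" by (simp add: abs_mult)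
    also have "\<dots> \<le> \<bar>sqfree_prod w d\<bar> * (x / real d) powr \<sigma>"
      using abs_nat_div_minus_le_powr[of x \<sigma> d] x \<sigma> False by (intro mult_left_mono) auto
    also have "\<dots> = x powr \<sigma> * g d" using x by (simp add: g_def powr_divide)
    finally show ?thesis .
  qed (simp add: g_def)
  have "\<bar>(\<Sum>n=1..?N. rad_prod w n) - x * (\<Sum>d. sqfree_prod w d / real d)\<bar>
      \<le> (\<Sum>d. x powr \<sigma> * g d)"
    using norm_suminf_le[OF le summable_mult[OF sg]] unfolding sums_unique[OF diff, symmetric]
    by simp
  then show ?thesis
    unfolding g_eq using sg by (simp add: sqfree_prod_divide suminf_mult)
qed

section \<open>Partial summation\<close>

text \<open>Abel summation by induction: the earlier partial sum is nonnegative, so replacing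
  \<open>g N\<close> by the smaller \<open>g (Suc N)\<close> can only lower its product with that
  sum.\<close>

lemma sum_mult_decreasing_ge:
  fixes \<alpha> g :: "nat \<Rightarrow> real"
  assumes "\<And>j. j \<in> {1..N} \<Longrightarrow> (\<Sum>m=1..j. \<alpha> m) \<ge> 0"
    and "\<And>j. j \<in> {1..<N} \<Longrightarrow> g (Suc j) \<le> g j"
  shows "(\<Sum>m=1..N. \<alpha> m * g m) \<ge> (\<Sum>m=1..N. \<alpha> m) * g N"
  using assms
proof (induction N)
  case (Suc N)
  have "(\<Sum>m=1..N. \<alpha> m) * g (Suc N) \<le> (\<Sum>m=1..N. \<alpha> m) * g N"
  proof (cases "N = 0")
    case False
    then show ?thesis using Suc.prems(1)[of N] Suc.prems(2)[of N] by (intro mult_left_mono) auto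
  qed auto
  also have "\<dots> \<le> (\<Sum>m=1..N. \<alpha> m * g m)" using Suc by auto
  finally show ?case by (simp add: algebra_simps)
qed auto

text \<open>The preceding inequality is applied to \<open>\<sigma> + \<beta>\<close> and
  \<open>\<sigma> - \<beta>\<close>, whose partial sums are nonnegative. A bound on partial sums is
  used by first writing it as the partial sums of a sequence \<sigma>.\<close>

lemma abs_sum_mult_decreasing_le:
  fixes \<beta> \<sigma> g :: "nat \<Rightarrow> real"
  assumes le: "\<And>j. j \<in> {1..N} \<Longrightarrow> \<bar>\<Sum>m=1..j. \<beta> m\<bar> \<le> (\<Sum>m=1..j. \<sigma> m)"
    and dec: "\<And>j. j \<in> {1..<N} \<Longrightarrow> g (Suc j) \<le> g j"
    and nonneg: "g N \<ge> 0"
  shows "\<bar>\<Sum>m=1..N. \<beta> m * g m\<bar> \<le> (\<Sum>m=1..N. \<sigma> m * g m)"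
proof (cases "N = 0")
  case False
  have "(\<Sum>m=1..N. (\<sigma> m + c * \<beta> m) * g m) \<ge> 0" if c: "c \<in> {1, -1}" for c
  proof -
    have nn: "(\<Sum>m=1..j. \<sigma> m + c * \<beta> m) \<ge> 0" if "j \<in> {1..N}" for j
      using le[OF that] c by (auto simp: sum.distrib sum_negf)
    then have "0 \<le> (\<Sum>m=1..N. \<sigma> m + c * \<beta> m) * g N"
      using False nonneg nn[of N] by (intro mult_nonneg_nonneg) auto
    also have "\<dots> \<le> (\<Sum>m=1..N. (\<sigma> m + c * \<beta> m) * g m)"
      by (rule sum_mult_decreasing_ge) (use nn dec in auto)
    finally show ?thesis .
  qed
  from this[of 1] this[of "-1"] show ?thesis
    by (auto simp: algebra_simps sum.distrib sum_subtractf)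
qed auto

text \<open>Turns a power bound on partial sums into partial sums, as Abel summation requires. It
  rests on \<open>T * (T + 1) = 2 * (1 + ... + T)\<close> and on the decrease of
  \<open>x powr (\<theta> - 1)\<close>.\<close>

lemma powr_le_sum_powr:
  assumes "0 \<le> \<theta>" "\<theta> \<le> 1"
  shows "real T powr (1 + \<theta>) \<le> (\<Sum>m=1..T. 2 * real m powr \<theta>)"
proof (cases "T = 0")
  case False
  have "real T powr (1 + \<theta>) \<le> real (T * (T + 1)) * real T powr (\<theta> - 1)"
  proof -
    have "real T powr (1 + \<theta>) = (real T * real T) * real T powr (\<theta> - 1)"
      using False by (simp add: powr_add powr_diff)
    also have "\<dots> \<le> real (T * (T + 1)) * real T powr (\<theta> - 1)"
      by (intro mult_right_mono) auto
    finally show ?thesis .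
  qed
  also have "real (T * (T + 1)) = (\<Sum>m=1..T. 2 * real m)"
    by (induction T) (auto simp: algebra_simps)
  also have "\<dots> * real T powr (\<theta> - 1) = (\<Sum>m=1..T. 2 * real m * real T powr (\<theta> - 1))"
    by (simp add: sum_distrib_right)
  also have "\<dots> \<le> (\<Sum>m=1..T. 2 * real m powr \<theta>)"
  proof (rule sum_mono)
    fix m assume m: "m \<in> {1..T}"
    then have "real T powr (\<theta> - 1) \<le> real m powr (\<theta> - 1)"
      using assms by (intro powr_mono2') auto
    then have "real m * real T powr (\<theta> - 1) \<le> real m * real m powr (\<theta> - 1)"
      by (intro mult_left_mono) auto
    also have "\<dots> = real m powr \<theta>" using m by (simp add: powr_diff)
    finally show "2 * real m * real T powr (\<theta> - 1) \<le> 2 * real m powr \<theta>" by simp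
  qed
  finally show ?thesis .
qed auto

lemma sum_inverse_nat_floor_approx:
  assumes "z \<ge> 1"
  shows "\<bar>(\<Sum>m=1..nat \<lfloor>z\<rfloor>. 1 / real m) - ln z\<bar> \<le> 1"
proof -
  define N where "N = nat \<lfloor>z\<rfloor>"
  have N: "N \<ge> 1" "real N \<le> z" "z \<le> real N + 1"
    using assms by (auto simp: N_def le_nat_iff of_nat_floor)
  have h: "harm N = (\<Sum>m=1..N. 1 / real m)" by (simp add: harm_def divide_inverse)
  have "ln z \<le> ln (real N + 1)" using assms N by simp
  also have "\<dots> \<le> harm N" by (rule ln_le_harm)
  finally have 1: "ln z \<le> harm N" .
  have "harm N - ln (real N) \<le> harm 1 - ln (real 1)"
    using euler_mascheroni_sequence_decreasing[of 1 N] N by simp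
  then have "harm N \<le> 1 + ln (real N)" by (simp add: harm_expand)
  also have "ln (real N) \<le> ln z" using N assms by simp
  finally show ?thesis using 1 unfolding N_def[symmetric] h[symmetric] by linarith
qed

text \<open>The sequence \<open>r\<close> is compared with \<open>2 * E * m\<close>, whose partial
  sums are \<open>E * T * (T + 1)\<close> and which produces the logarithm. The difference has
  partial sums of order \<open>T powr (7/4)\<close>, so after division by \<open>m ^ 2\<close> it is
  controlled by the convergent sum of \<open>m powr (-5/4)\<close>.\<close>

lemma sum_div_square_approx_ln:
  assumes r: "\<And>T. \<bar>(\<Sum>m=1..T. r m) - E * real T ^ 2\<bar> \<le> C * real T powr (7/4)"
    and z: "z \<ge> 1"
  shows "\<bar>(\<Sum>m=1..nat \<lfloor>z\<rfloor>. r m / real m ^ 2) - 2 * E * ln z\<bar>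
    \<le> 2 * (C + \<bar>E\<bar>) * (\<Sum>m. real m powr (-5/4)) + 2 * \<bar>E\<bar>"
proof -
  define N where "N = nat \<lfloor>z\<rfloor>"
  have C: "C \<ge> 0" using r[of 1] by (auto intro: order_trans[OF abs_ge_zero])
  have s: "\<bar>\<Sum>m=1..j. r m - 2 * E * real m\<bar> \<le> (\<Sum>m=1..j. (C + \<bar>E\<bar>) * (2 * real m powr (3/4)))" for j
  proof (cases "j = 0")
    case False
    have "(\<Sum>m=1..j. r m - 2 * E * real m) = (\<Sum>m=1..j. r m) - E * real j ^ 2 - E * real j"
    proof -
      have "(\<Sum>m=1..j. 2 * E * real m) = E * real j ^ 2 + E * real j"
        by (induction j) (auto simp: algebra_simps power2_eq_square)
      then show ?thesis by (simp only: sum_subtractf)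
    qed
    then have "\<bar>\<Sum>m=1..j. r m - 2 * E * real m\<bar> \<le> C * real j powr (7/4) + \<bar>E\<bar> * real j"
      using r[of j] abs_mult[of E "real j"] by auto
    also have "\<bar>E\<bar> * real j \<le> \<bar>E\<bar> * real j powr (7/4)"
      using False powr_mono[of 1 "7/4" "real j"] by (intro mult_left_mono) auto
    also have "C * real j powr (7/4) + \<bar>E\<bar> * real j powr (7/4) = (C + \<bar>E\<bar>) * real j powr (1 + 3/4)"
      by (simp add: algebra_simps)
    also have "\<dots> \<le> (C + \<bar>E\<bar>) * (\<Sum>m=1..j. 2 * real m powr (3/4))"
      using C by (intro mult_left_mono powr_le_sum_powr) auto
    finally show ?thesis by (simp only: sum_distrib_left)
  qed auto
  have "\<bar>\<Sum>m=1..N. (r m - 2 * E * real m) * (1 / real m ^ 2)\<bar>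
      \<le> (\<Sum>m=1..N. (C + \<bar>E\<bar>) * (2 * real m powr (3/4)) * (1 / real m ^ 2))"
    by (rule abs_sum_mult_decreasing_le[OF s]) (auto intro!: divide_left_mono power_mono)
  also have "\<dots> = 2 * (C + \<bar>E\<bar>) * (\<Sum>m=1..N. real m powr (-5/4))"
  proof -
    have "real m powr (3/4) * (1 / real m ^ 2) = real m powr (-5/4)" if "m \<ge> 1" for m
    proof -
      have "real m powr (3/4 - 2) = real m powr (3/4) / real m powr 2" by (rule powr_diff)
      then show ?thesis using that by simp
    qed
    then show ?thesis by (simp add: sum_distrib_left algebra_simps)
  qed
  also have "\<dots> \<le> 2 * (C + \<bar>E\<bar>) * (\<Sum>m. real m powr (-5/4))"
    using C by (intro mult_left_mono sum_le_suminf) (auto simp: summable_real_powr_iff)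
  finally have 1: "\<bar>\<Sum>m=1..N. (r m - 2 * E * real m) * (1 / real m ^ 2)\<bar> \<le> \<dots>" .
  have "(\<Sum>m=1..N. (r m - 2 * E * real m) * (1 / real m ^ 2)) =
      (\<Sum>m=1..N. r m / real m ^ 2 - 2 * E * (1 / real m))"
    by (rule sum.cong) (auto simp: field_simps power2_eq_square)
  also have "\<dots> = (\<Sum>m=1..N. r m / real m ^ 2) - 2 * E * (\<Sum>m=1..N. 1 / real m)"
    by (simp add: sum_subtractf sum_distrib_left)
  finally have 2: "(\<Sum>m=1..N. (r m - 2 * E * real m) * (1 / real m ^ 2)) =
      (\<Sum>m=1..N. r m / real m ^ 2) - 2 * E * (\<Sum>m=1..N. 1 / real m)" .
  have "\<bar>2 * E * ((\<Sum>m=1..N. 1 / real m) - ln z)\<bar> \<le> 2 * \<bar>E\<bar> * 1"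
    unfolding abs_mult N_def using sum_inverse_nat_floor_approx[OF z] by (intro mult_mono) auto
  then have "\<bar>2 * E * (\<Sum>m=1..N. 1 / real m) - 2 * E * ln z\<bar> \<le> 2 * \<bar>E\<bar>"
    by (simp add: algebra_simps)
  then show ?thesis using 1 2 unfolding N_def[symmetric] by linarith
qed

text \<open>\<open>G\<close> is minus an antiderivative of \<open>ln (Y / x) / x\<close>. As long as
  the arguments stay below \<open>Y\<close>, the difference \<open>G m - G (Suc m)\<close> lies
  between the summands at \<open>Suc m\<close> and at \<open>m\<close>, so the sum telescopes from
  both sides.\<close>

lemma sum_ln_div_approx:
  assumes Y: "Y \<ge> 1"
  shows "\<bar>(\<Sum>m=1..nat \<lfloor>Y\<rfloor>. 1 / real m * ln (Y / real m)) - (ln Y)\<^sup>2 / 2\<bar> \<le> ln Y + 1"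
proof -
  define h where "h = (\<lambda>m. 1 / real m * ln (Y / real m))"
  define G where "G = (\<lambda>m. (ln (Y / real m))\<^sup>2 / 2)"
  define N where "N = nat \<lfloor>Y\<rfloor>"
  have N: "N \<ge> 1" "real N \<le> Y" "Y \<le> real N + 1"
    using assms by (auto simp: N_def le_nat_iff of_nat_floor)
  have dG: "G m - G (Suc m) \<le> h m" "real (Suc m) \<le> Y \<Longrightarrow> h (Suc m) \<le> G m - G (Suc m)"
    if m: "m \<ge> 1" "real m \<le> Y" for m
  proof -
    define d where "d = ln (1 + 1 / real m)"
    have d: "1 / real (Suc m) \<le> d" "d \<le> 1 / real m" "d \<ge> 0"
    proof -
      have eq: "d = ln (real (Suc m)) - ln (real m)"
      proof -
        have "1 + 1 / real m = real (Suc m) / real m" using m by (simp add: field_simps)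
        then show ?thesis using m ln_div[of "real (Suc m)" "real m"] by (simp add: d_def)
      qed
      show "d \<ge> 0" using m by (simp add: eq)
      show "d \<le> 1 / real m" unfolding d_def using ln_add_one_self_le_self[of "1 / real m"] by simp
      have "ln (real m / real (Suc m)) \<le> real m / real (Suc m) - 1"
        using m by (intro ln_le_minus_one) auto
      then show "1 / real (Suc m) \<le> d" using m unfolding eq by (simp add: ln_div field_simps)
    qed
    have lns: "ln (Y / real m) = ln (Y / real (Suc m)) + d"
    proof -
      have "1 + 1 / real m = real (Suc m) / real m" using m by (simp add: field_simps)
      then have "Y / real m = Y / real (Suc m) * (1 + 1 / real m)" using m by simp
      then show ?thesis
        using m Y ln_mult_pos[of "Y / real (Suc m)" "1 + 1 / real m"] by (simp add: d_def add_pos_nonneg)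
    qed
    have nn: "ln (Y / real m) \<ge> 0" using m by simp
    have "G m - G (Suc m) = ln (Y / real m) * d - d\<^sup>2 / 2"
      unfolding G_def using lns by (simp add: power2_eq_square algebra_simps)
    also have "\<dots> \<le> ln (Y / real m) * d" by simp
    also have "\<dots> \<le> ln (Y / real m) * (1 / real m)" using nn d by (intro mult_left_mono) auto
    finally show "G m - G (Suc m) \<le> h m" by (simp add: h_def)
    assume "real (Suc m) \<le> Y"
    then have nn: "ln (Y / real (Suc m)) \<ge> 0" using m by simp
    have "h (Suc m) \<le> ln (Y / real (Suc m)) * d"
      unfolding h_def using nn d mult_left_mono[of "1 / real (Suc m)" d "ln (Y / real (Suc m))"]
      by (simp add: mult.commute)
    also have "\<dots> \<le> ln (Y / real (Suc m)) * d + d\<^sup>2 / 2" by simp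
    also have "\<dots> = G m - G (Suc m)"
      unfolding G_def lns by (simp add: power2_eq_square algebra_simps)
    finally show "h (Suc m) \<le> G m - G (Suc m)" .
  qed
  have low: "(\<Sum>m=1..n. h m) \<ge> G 1 - G (Suc n)" if "real n \<le> Y" for n
    using that
  proof (induction n)
    case (Suc n)
    have "G 1 - G (Suc (Suc n)) = (G 1 - G (Suc n)) + (G (Suc n) - G (Suc (Suc n)))" by simp
    also have "\<dots> \<le> (\<Sum>m=1..n. h m) + h (Suc n)"
      using Suc dG(1)[of "Suc n"] by (intro add_mono) auto
    finally show ?case by simp
  qed auto
  have up: "(\<Sum>m=1..n. h m) \<le> h 1 + G 1 - G n" if "n \<ge> 1" "real n \<le> Y" for n
    using that
  proof (induction n rule: dec_induct)
    case (step n)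
    then show ?case using dG(2)[of n] by auto
  qed auto
  have G1: "G 1 = (ln Y)\<^sup>2 / 2" "h 1 = ln Y" by (auto simp: G_def h_def)
  have "G N \<ge> 0" by (simp add: G_def)
  then have u: "(\<Sum>m=1..N. h m) \<le> ln Y + (ln Y)\<^sup>2 / 2" using up[OF N(1,2)] G1 by simp
  \<comment> \<open>The endpoint \<open>Suc N\<close> may lie beyond \<open>Y\<close>, where
    \<open>G\<close> no longer decreases. Since \<open>N \<ge> 1\<close>, the ratio
    \<open>Y / Suc N\<close> is still at least 1/2, so the overshoot costs only a constant.\<close>
  have "G (Suc N) \<le> 1"
  proof -
    define v where "v = Y / real (Suc N)"
    have v: "1/2 \<le> v" "v \<le> 1" using N unfolding v_def by (auto simp: field_simps)
    have "- ln v \<le> ln 2" using v ln_mono[of "1/2" v] by (simp add: ln_div)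
    then have "\<bar>ln v\<bar> \<le> 1" using v ln_2_less_1 by (auto simp: abs_le_iff)
    then have "(ln v)\<^sup>2 \<le> 1" by (simp add: abs_square_le_1)
    then show ?thesis by (simp add: G_def v_def)
  qed
  then have "(\<Sum>m=1..N. h m) \<ge> (ln Y)\<^sup>2 / 2 - 1" using low[OF N(2)] G1 by simp
  moreover have "ln Y \<ge> 0" using Y by simp
  ultimately have "\<bar>(\<Sum>m=1..N. h m) - (ln Y)\<^sup>2 / 2\<bar> \<le> ln Y + 1"
    using u unfolding abs_le_iff by linarith
  then show ?thesis by (simp only: N_def h_def)
qed

text \<open>\<alpha> is compared with \<open>\<kappa> / m\<close>, whose weighted sum is given by
  \<open>sum_ln_div_approx\<close>; the difference has bounded partial sums.\<close>

lemma sum_mult_ln_approx: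
  assumes \<alpha>: "\<And>j. j \<ge> 1 \<Longrightarrow> \<bar>(\<Sum>m=1..j. \<alpha> m) - \<kappa> * ln (real j)\<bar> \<le> C"
    and Y: "Y \<ge> 1"
  shows "\<bar>(\<Sum>m=1..nat \<lfloor>Y\<rfloor>. \<alpha> m * ln (Y / real m)) - \<kappa> / 2 * (ln Y)\<^sup>2\<bar>
    \<le> (C + \<bar>\<kappa>\<bar>) * ln Y + \<bar>\<kappa>\<bar> * (ln Y + 1)"
proof -
  define N where "N = nat \<lfloor>Y\<rfloor>"
  have N: "N \<ge> 1" "real N \<le> Y"
    using assms by (auto simp: N_def le_nat_iff of_nat_floor)
  \<comment> \<open>The majorant is a point mass at 1: its partial sums are constant, so the bounded
    error is multiplied by the largest weight \<open>ln Y\<close> only.\<close>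
  have "\<bar>\<Sum>m=1..N. (\<alpha> m - \<kappa> * (1 / real m)) * ln (Y / real m)\<bar>
      \<le> (\<Sum>m=1..N. (if m = 1 then C + \<bar>\<kappa>\<bar> else 0) * ln (Y / real m))"
  proof (rule abs_sum_mult_decreasing_le)
    fix j assume j: "j \<in> {1..N}"
    have h: "\<bar>\<kappa> * ((\<Sum>m=1..j. 1 / real m) - ln (real j))\<bar> \<le> \<bar>\<kappa>\<bar> * 1"
      unfolding abs_mult using sum_inverse_nat_floor_approx[of "real j"] j
      by (intro mult_left_mono) auto
    have "(\<Sum>m=1..j. \<alpha> m - \<kappa> * (1 / real m)) =
        ((\<Sum>m=1..j. \<alpha> m) - \<kappa> * ln (real j)) - \<kappa> * ((\<Sum>m=1..j. 1 / real m) - ln (real j))"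
      by (simp only: sum_subtractf sum_distrib_left[symmetric]) (simp add: algebra_simps)
    then have "\<bar>\<Sum>m=1..j. \<alpha> m - \<kappa> * (1 / real m)\<bar> \<le> C + \<bar>\<kappa>\<bar>"
      using h \<alpha>[of j] j by auto
    also have "\<dots> = (\<Sum>m=1..j. (if m = 1 then C + \<bar>\<kappa>\<bar> else 0))"
      using j by (simp add: sum.delta)
    finally show "\<bar>\<Sum>m=1..j. \<alpha> m - \<kappa> * (1 / real m)\<bar> \<le> \<dots>" .
  next
    fix j assume "j \<in> {1..<N}"
    then show "ln (Y / real (Suc j)) \<le> ln (Y / real j)"
      using Y by (intro ln_mono divide_left_mono) auto
  qed (use N in auto)
  also have "\<dots> = (C + \<bar>\<kappa>\<bar>) * ln Y"
    using N by (simp add: if_distrib[of "\<lambda>x. x * _"] sum.delta cong: if_cong)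
  also have "(\<Sum>m=1..N. (\<alpha> m - \<kappa> * (1 / real m)) * ln (Y / real m)) =
      (\<Sum>m=1..N. \<alpha> m * ln (Y / real m)) - \<kappa> * (\<Sum>m=1..N. 1 / real m * ln (Y / real m))"
    by (simp add: sum_subtractf sum_distrib_left algebra_simps)
  finally have 1: "\<bar>(\<Sum>m=1..N. \<alpha> m * ln (Y / real m))
      - \<kappa> * (\<Sum>m=1..N. 1 / real m * ln (Y / real m))\<bar> \<le> (C + \<bar>\<kappa>\<bar>) * ln Y" .
  have "\<bar>\<kappa> * ((\<Sum>m=1..N. 1 / real m * ln (Y / real m)) - (ln Y)\<^sup>2 / 2)\<bar> \<le> \<bar>\<kappa>\<bar> * (ln Y + 1)"
    unfolding abs_mult N_def using sum_ln_div_approx[OF Y] by (intro mult_left_mono) auto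
  then have "\<bar>\<kappa> * (\<Sum>m=1..N. 1 / real m * ln (Y / real m)) - \<kappa> / 2 * (ln Y)\<^sup>2\<bar> \<le> \<bar>\<kappa>\<bar> * (ln Y + 1)"
    by (simp add: algebra_simps)
  with 1 show ?thesis unfolding N_def by linarith
qed

section \<open>Coprime pairs with multiplicative weights\<close>

text \<open>For \<open>n > 0\<close> this is Euler's totient of \<open>n\<close> divided by
  \<open>n\<close>.\<close>

definition tot_ratio :: "nat \<Rightarrow> real" where
  "tot_ratio = rad_prod (\<lambda>p. - (1 / real p))"

text \<open>For \<open>n > 0\<close> this is the sum of \<open>d powr (-3/4)\<close> over the
  squarefree divisors \<open>d\<close> of \<open>n\<close>, the cost of sieving by the primes of
  \<open>n\<close>.\<close>

definition divisor_weight :: "nat \<Rightarrow> real" where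
  "divisor_weight = rad_prod (\<lambda>p. 1 / real p powr (3/4))"

text \<open>Sorted by the maximum because the height sees a pair only through it.\<close>

definition coprime_pairs :: "nat \<Rightarrow> (nat \<times> nat) set" where
  "coprime_pairs m = {(x, y). x \<ge> 1 \<and> y \<ge> 1 \<and> coprime x y \<and> max x y = m}"

text \<open>The coprime pairs \<open>(x, y)\<close> with \<open>x, y \<le> T\<close>, weighted by the product of \<open>1 - s p\<close> over the
  primes \<open>p\<close> dividing \<open>y\<close>, have total weight asymptotic to \<open>pair_density s * T\<^sup>2\<close>.\<close>

definition pair_density :: "(nat \<Rightarrow> real) \<Rightarrow> real" where
  "pair_density s = (\<Sum>d. sqfree_prod (\<lambda>p. ((1 - s p) * (1 - 1 / real p) - 1) / real p) d)"

text \<open>The range of weights over which the estimates below are uniform. At \<open>p = 0\<close>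
  the convention \<open>1 / 0 = 0\<close> forces \<open>s 0 = 0\<close>, so series may run over all
  natural numbers.\<close>

definition admissible :: "(nat \<Rightarrow> real) \<Rightarrow> bool" where
  "admissible s \<longleftrightarrow> (\<forall>p. 0 \<le> s p \<and> s p \<le> 1 / real p)"

lemma abs_local_defect_le:
  assumes "admissible s"
  shows "\<bar>(1 - s p) * (1 - 1 / real p) - 1\<bar> \<le> 2 / real p"
proof (cases "p = 0")
  case False
  have s: "0 \<le> s p" "s p \<le> 1 / real p" using assms by (auto simp: admissible_def)
  have p: "1 / real p \<le> 1" "0 \<le> 1 / real p" using False by auto
  have "s p * (1 / real p) \<le> s p * 1" using p s by (intro mult_left_mono) auto
  moreover have "0 \<le> s p * (1 / real p)" using p s by (intro mult_nonneg_nonneg) auto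
  moreover have "(1 - s p) * (1 - 1 / real p) - 1 = - s p - 1 / real p + s p * (1 / real p)"
    by (simp add: algebra_simps diff_divide_distrib)
  moreover have "2 / real p = 2 * (1 / real p)" by simp
  ultimately show ?thesis using s p by linarith
qed (use assms[unfolded admissible_def, rule_format, of 0] in auto)

lemma rad_prod_nonneg:
  assumes "\<And>p. prime p \<Longrightarrow> w p \<ge> -1"
  shows "rad_prod w n \<ge> 0"
  unfolding rad_prod_def
proof (rule prod_nonneg)
  fix p assume "p \<in> prime_factors n"
  then have "prime p" by auto
  then show "0 \<le> 1 + w p" using assms[of p] by simp
qed

lemma rad_prod_le_1:
  assumes "\<And>p. prime p \<Longrightarrow> - 1 \<le> w p" "\<And>p. prime p \<Longrightarrow> w p \<le> 0"
  shows "rad_prod w n \<le> 1"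
  unfolding rad_prod_def
proof (rule prod_le_1)
  fix p assume "p \<in> prime_factors n"
  then have "prime p" by auto
  then show "0 \<le> 1 + w p \<and> 1 + w p \<le> 1" using assms[of p] by simp
qed

lemma rad_prod_mult:
  "rad_prod v n * rad_prod w n = rad_prod (\<lambda>p. (1 + v p) * (1 + w p) - 1) n"
  by (simp add: rad_prod_def prod.distrib)

lemma divisor_weight_nonneg: "divisor_weight n \<ge> 0"
  unfolding divisor_weight_def by (intro rad_prod_nonneg) (auto intro: order_trans[of _ 0])

text \<open>The indicator of coprimality to \<open>k\<close> is \<open>rad_prod w\<close> with
  weight -1 at the primes of \<open>k\<close> and 0 elsewhere. The finite Euler products at the
  exponents 1 and 3/4 are then \<open>tot_ratio k\<close> and
  \<open>divisor_weight k\<close>.\<close>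

lemma card_coprime_approx:
  assumes k: "k > 0" and x: "x \<ge> 0"
  shows "\<bar>real (card {a\<in>{1..nat \<lfloor>x\<rfloor>}. coprime a k}) - x * tot_ratio k\<bar>
    \<le> x powr (3/4) * divisor_weight k"
proof -
  define w where "w = (\<lambda>p. if p \<in> prime_factors k then -1 else 0 :: real)"
  have fin: "finite {p. w p \<noteq> 0}"
    by (rule finite_subset[of _ "prime_factors k"]) (auto simp: w_def)
  have "rad_prod w a = (if coprime a k then 1 else 0)" if "a > 0" for a
  proof (cases "coprime a k")
    case True
    then have "p \<notin> prime_factors k" if "p \<in> prime_factors a" for p
      using that by (metis coprime_common_divisor in_prime_factors_iff not_prime_unit)
    then show ?thesis using True by (auto simp: rad_prod_def w_def intro!: prod.neutral)
  next
    case False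
    then obtain p where "prime p" "p dvd a" "p dvd k"
      using prime_factor_nat[of "gcd a k"] by (auto simp: coprime_iff_gcd_eq_1)
    then show ?thesis using False that k
      by (auto simp: rad_prod_def w_def in_prime_factors_iff intro!: prod_zero bexI[of _ p])
  qed
  then have "(\<Sum>n=1..nat \<lfloor>x\<rfloor>. rad_prod w n) = (\<Sum>n=1..nat \<lfloor>x\<rfloor>. if coprime n k then 1 else 0)"
    by (intro sum.cong) auto
  also have "\<dots> = (\<Sum>n\<in>{a\<in>{1..nat \<lfloor>x\<rfloor>}. coprime a k}. 1)"
    by (rule sum.inter_filter[symmetric]) simp
  finally have 1: "(\<Sum>n=1..nat \<lfloor>x\<rfloor>. rad_prod w n) = real (card {a\<in>{1..nat \<lfloor>x\<rfloor>}. coprime a k})"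
    by simp
  have 2: "(\<Sum>d. sqfree_prod (\<lambda>p. w p / real p) d) = tot_ratio k"
    by (subst suminf_sqfree_prod_finite_support[OF k])
      (auto simp: w_def tot_ratio_def rad_prod_def)
  have 3: "(\<Sum>d. sqfree_prod (\<lambda>p. \<bar>w p\<bar> / real p powr (3/4)) d) = divisor_weight k"
    by (subst suminf_sqfree_prod_finite_support[OF k])
      (auto simp: w_def divisor_weight_def rad_prod_def)
  have "summable (\<lambda>p. \<bar>w p\<bar> / real p powr (3/4))"
    by (rule summable_finite[of "{p. w p \<noteq> 0}"]) (use fin in auto)
  from sum_rad_prod_approx[OF x _ _ this] show ?thesis unfolding 1 2 3 by simp
qed

text \<open>Interchanging the sum with the sum over divisors gives at most \<open>T\<close> times
  the sum of \<open>d powr (-7/4)\<close> over squarefree \<open>d\<close>, which converges.\<close>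

lemma sum_divisor_weight_le: "\<exists>C\<ge>0. \<forall>T. (\<Sum>n=1..T. divisor_weight n) \<le> C * real T"
proof -
  define w where "w = (\<lambda>p::nat. 1 / real p powr (3/4))"
  have w: "\<bar>w p / real p\<bar> = 1 / real p powr (7/4)" for p
    using powr_add[of "real p" "3/4" 1] by (simp add: w_def)
  have "summable (\<lambda>p. \<bar>w p / real p\<bar>)"
    unfolding w using summable_real_powr_iff[of "-7/4"] by (simp add: powr_minus_divide)
  then have s: "summable (\<lambda>d. \<bar>sqfree_prod (\<lambda>p. w p / real p) d\<bar>)"
    by (rule summable_abs_sqfree_prod)
  have nn: "sqfree_prod w d \<ge> 0" for d
    by (auto simp: sqfree_prod_def w_def intro!: prod_nonneg)
  have "(\<Sum>n=1..T. divisor_weight n) \<le> (\<Sum>d. \<bar>sqfree_prod (\<lambda>p. w p / real p) d\<bar>) * real T" for T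
  proof -
    have "(\<Sum>n=1..T. divisor_weight n) = (\<Sum>d=1..T. sqfree_prod w d * real (T div d))"
      unfolding divisor_weight_def w_def[symmetric] by (rule sum_rad_prod_eq)
    also have "\<dots> \<le> (\<Sum>d=1..T. \<bar>sqfree_prod (\<lambda>p. w p / real p) d\<bar> * real T)"
    proof (rule sum_mono)
      fix d assume "d \<in> {1..T}"
      then have "sqfree_prod w d * real (T div d) \<le> sqfree_prod w d * (real T / real d)"
        using nn of_nat_div_le_of_nat by (intro mult_left_mono) auto
      also have "\<dots> = \<bar>sqfree_prod (\<lambda>p. w p / real p) d\<bar> * real T"
        using nn[of d] by (simp add: sqfree_prod_divide)
      finally show "sqfree_prod w d * real (T div d) \<le> \<dots>" .
    qed
    also have "\<dots> \<le> (\<Sum>d. \<bar>sqfree_prod (\<lambda>p. w p / real p) d\<bar>) * real T"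
      unfolding sum_distrib_right[symmetric] using s
      by (intro mult_right_mono sum_le_suminf) auto
    finally show ?thesis .
  qed
  moreover have "(\<Sum>d. \<bar>sqfree_prod (\<lambda>p. w p / real p) d\<bar>) \<ge> 0"
    using s by (intro suminf_nonneg) auto
  ultimately show ?thesis by blast
qed

text \<open>The pairs of maximum up to \<open>T\<close> fill the square of side \<open>T\<close>, so
  for each \<open>y\<close> only the number of \<open>x\<close> coprime to it matters.\<close>

lemma sum_coprime_pairs:
  "(\<Sum>m=1..T. \<Sum>b\<in>coprime_pairs m. h (snd b)) =
    (\<Sum>y=1..T. h y * real (card {x\<in>{1..T}. coprime x y}))"
proof -
  define S where "S = {b\<in>{1..T} \<times> {1..T}. coprime (fst b) (snd b)}"
  have "(\<Sum>m=1..T. \<Sum>b\<in>coprime_pairs m. h (snd b)) =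
      (\<Sum>m=1..T. \<Sum>b\<in>{b\<in>S. max (fst b) (snd b) = m}. h (snd b))"
    by (intro sum.cong) (auto simp: S_def coprime_pairs_def max_def split: if_splits)
  also have "\<dots> = (\<Sum>b\<in>S. h (snd b))"
    by (rule sum.group) (auto simp: S_def)
  also have "\<dots> = (\<Sum>b\<in>{1..T} \<times> {1..T}. if coprime (fst b) (snd b) then h (snd b) else 0)"
    unfolding S_def by (rule sum.inter_filter) simp
  also have "\<dots> = (\<Sum>x=1..T. \<Sum>y=1..T. if coprime x y then h y else 0)"
    by (simp add: sum.cartesian_product case_prod_beta)
  also have "\<dots> = (\<Sum>y=1..T. \<Sum>x=1..T. if coprime x y then h y else 0)"
    by (rule sum.swap)
  also have "\<dots> = (\<Sum>y=1..T. h y * real (card {x\<in>{1..T}. coprime x y}))"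
  proof (rule sum.cong[OF refl])
    fix y
    have "(\<Sum>x=1..T. if coprime x y then h y else 0) = (\<Sum>x\<in>{x\<in>{1..T}. coprime x y}. h y)"
      by (rule sum.inter_filter[symmetric]) simp
    then show "(\<Sum>x=1..T. if coprime x y then h y else 0) = h y * real (card {x\<in>{1..T}. coprime x y})"
      by simp
  qed
  finally show ?thesis .
qed

text \<open>For fixed \<open>y\<close> the number of \<open>x\<close> is
  \<open>T * tot_ratio y\<close> up to \<open>T powr (3/4) * divisor_weight y\<close>, and
  \<open>divisor_weight\<close> is bounded on average. The weight times \<open>tot_ratio\<close> is
  again a function of the radical, with mean value \<open>pair_density s\<close>.\<close>

lemma coprime_pairs_approx:
  "\<exists>C\<ge>0. \<forall>s. admissible s \<longrightarrow> \<bar>pair_density s\<bar> \<le> C \<and>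
    (\<forall>T. \<bar>(\<Sum>m=1..T. \<Sum>b\<in>coprime_pairs m. rad_prod (\<lambda>p. - s p) (snd b)) - pair_density s * real T ^ 2\<bar>
      \<le> C * real T powr (7/4))"
proof -
  obtain K1 where K1: "K1 \<ge> 0" "\<And>T. (\<Sum>n=1..T. divisor_weight n) \<le> K1 * real T"
    using sum_divisor_weight_le by blast
  \<comment> \<open>One majorant for every admissible \<open>s\<close>, serving both the main series
    at exponent 1 and the error series at exponent 3/4; this makes the constants uniform.\<close>
  define u where "u = (\<lambda>p::nat. 2 / real p powr (7/4))"
  have su: "summable u"
  proof -
    have "u = (\<lambda>p. 2 * real p powr (-7/4))"
      by (rule ext) (simp add: u_def powr_minus_divide)
    then show ?thesis by (auto simp: summable_real_powr_iff intro!: summable_mult)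
  qed
  define K2 where "K2 = exp (\<Sum>p. u p)"
  have main: "\<bar>pair_density s\<bar> \<le> K2 \<and>
      \<bar>(\<Sum>m=1..T. \<Sum>b\<in>coprime_pairs m. rad_prod (\<lambda>p. - s p) (snd b)) - pair_density s * real T ^ 2\<bar>
      \<le> (K1 + K2) * real T powr (7/4)"
    if s: "\<And>p. 0 \<le> s p" "\<And>p. s p \<le> 1 / real p" for s T
  proof -
    define w where "w = (\<lambda>p. (1 - s p) * (1 - 1 / real p) - 1)"
    have w_le: "\<bar>w p\<bar> \<le> 2 / real p" for p
      unfolding w_def using s by (intro abs_local_defect_le) (simp add: admissible_def)
    have wu: "\<bar>w p\<bar> / real p powr \<theta> \<le> u p" if "\<theta> \<ge> 3/4" for p \<theta>
    proof (cases "p = 0")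
      case False
      have "\<bar>w p\<bar> / real p powr \<theta> \<le> (2 / real p) / real p powr (3/4)"
        using w_le[of p] False that by (intro frac_le powr_mono) auto
      also have "\<dots> = u p" using False powr_add[of "real p" 1 "3/4"] by (simp add: u_def)
      finally show ?thesis .
    qed (simp add: u_def)
    have smm: "summable (\<lambda>p. \<bar>\<bar>w p\<bar> / real p powr \<theta>\<bar>)" and
      exp_le: "exp (\<Sum>p. \<bar>\<bar>w p\<bar> / real p powr \<theta>\<bar>) \<le> K2" if "\<theta> \<ge> 3/4" for \<theta>
    proof -
      show sm: "summable (\<lambda>p. \<bar>\<bar>w p\<bar> / real p powr \<theta>\<bar>)"
        by (rule summable_comparison_test'[OF su, of 0]) (use wu[OF that] in auto)
      show "exp (\<Sum>p. \<bar>\<bar>w p\<bar> / real p powr \<theta>\<bar>) \<le> K2"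
        unfolding K2_def exp_le_cancel_iff
        by (rule suminf_le[OF _ sm su]) (use wu[OF that] in simp)
    qed
    have pd: "pair_density s = (\<Sum>d. sqfree_prod (\<lambda>p. w p / real p) d)"
      by (simp only: pair_density_def w_def)
    have E: "\<bar>pair_density s\<bar> \<le> K2"
    proof -
      have a: "\<bar>w p / real p\<bar> = \<bar>\<bar>w p\<bar> / real p powr 1\<bar>" for p by (cases "p = 0") auto
      have sm: "summable (\<lambda>p. \<bar>w p / real p\<bar>)" unfolding a by (rule smm) simp
      have "\<bar>pair_density s\<bar> \<le> (\<Sum>d. \<bar>sqfree_prod (\<lambda>p. w p / real p) d\<bar>)"
        unfolding pd by (rule summable_rabs[OF summable_abs_sqfree_prod[OF sm]])
      also have "\<dots> \<le> exp (\<Sum>p. \<bar>w p / real p\<bar>)"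
        by (rule suminf_abs_sqfree_prod_le[OF sm])
      also have "\<dots> \<le> K2" unfolding a by (rule exp_le) simp
      finally show ?thesis .
    qed
    have "\<bar>(\<Sum>n=1..nat \<lfloor>real T\<rfloor>. rad_prod w n) - real T * (\<Sum>d. sqfree_prod (\<lambda>p. w p / real p) d)\<bar>
        \<le> real T powr (3/4) * (\<Sum>d. sqfree_prod (\<lambda>p. \<bar>w p\<bar> / real p powr (3/4)) d)"
      by (rule sum_rad_prod_approx) (use smm[of "3/4"] in auto)
    also have "\<dots> \<le> real T powr (3/4) * K2"
    proof (rule mult_left_mono)
      have "sqfree_prod (\<lambda>p. \<bar>w p\<bar> / real p powr (3/4)) d = \<bar>sqfree_prod (\<lambda>p. \<bar>w p\<bar> / real p powr (3/4)) d\<bar>" for d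
        by (simp add: abs_sqfree_prod)
      then have "(\<Sum>d. sqfree_prod (\<lambda>p. \<bar>w p\<bar> / real p powr (3/4)) d) \<le> exp (\<Sum>p. \<bar>\<bar>w p\<bar> / real p powr (3/4)\<bar>)"
        using suminf_abs_sqfree_prod_le[OF smm[of "3/4"]] by simp
      also have "\<dots> \<le> K2" by (rule exp_le) simp
      finally show "(\<Sum>d. sqfree_prod (\<lambda>p. \<bar>w p\<bar> / real p powr (3/4)) d) \<le> K2" .
    qed auto
    finally have m1: "\<bar>(\<Sum>n=1..T. rad_prod w n) - real T * pair_density s\<bar> \<le> real T powr (3/4) * K2"
      unfolding pd by simp
    define c where "c = (\<lambda>y. real (card {x\<in>{1..T}. coprime x y}))"
    define v where "v = rad_prod (\<lambda>p. - s p)"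
    have v01: "0 \<le> v y" "v y \<le> 1" for y
    proof -
      have "s p \<le> 1" if "prime p" for p
        using s(2)[of p] prime_gt_0_nat[OF that] by (auto intro: order_trans)
      then show "0 \<le> v y" "v y \<le> 1" unfolding v_def
        using s(1) by (auto intro!: rad_prod_nonneg rad_prod_le_1)
    qed
    have vt: "v y * tot_ratio y = rad_prod w y" for y
      unfolding v_def tot_ratio_def rad_prod_mult w_def by simp
    have "\<bar>(\<Sum>y=1..T. v y * c y) - real T * (\<Sum>y=1..T. rad_prod w y)\<bar>
        = \<bar>\<Sum>y=1..T. v y * (c y - real T * tot_ratio y)\<bar>"
      by (simp add: vt[symmetric] sum_distrib_left sum_subtractf algebra_simps)
    also have "\<dots> \<le> (\<Sum>y=1..T. \<bar>v y * (c y - real T * tot_ratio y)\<bar>)" by (rule sum_abs)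
    also have "\<dots> \<le> (\<Sum>y=1..T. 1 * (real T powr (3/4) * divisor_weight y))"
    proof (rule sum_mono)
      fix y assume "y \<in> {1..T}"
      then have "\<bar>c y - real T * tot_ratio y\<bar> \<le> real T powr (3/4) * divisor_weight y"
        using card_coprime_approx[of y "real T"] by (simp add: c_def)
      then show "\<bar>v y * (c y - real T * tot_ratio y)\<bar> \<le> 1 * (real T powr (3/4) * divisor_weight y)"
        unfolding abs_mult using v01 by (intro mult_mono) auto
    qed
    also have "\<dots> = real T powr (3/4) * (\<Sum>y=1..T. divisor_weight y)"
      by (simp add: sum_distrib_left)
    also have "\<dots> \<le> real T powr (3/4) * (K1 * real T)"
      by (intro mult_left_mono K1) auto
    finally have m2: "\<bar>(\<Sum>y=1..T. v y * c y) - real T * (\<Sum>y=1..T. rad_prod w y)\<bar>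
        \<le> real T powr (3/4) * (K1 * real T)" .
    have "\<bar>real T * ((\<Sum>n=1..T. rad_prod w n) - real T * pair_density s)\<bar> \<le> real T * (real T powr (3/4) * K2)"
      unfolding abs_mult using m1 by (intro mult_mono) auto
    then have m3: "\<bar>real T * (\<Sum>n=1..T. rad_prod w n) - pair_density s * real T ^ 2\<bar>
        \<le> real T * (real T powr (3/4) * K2)"
      by (simp add: algebra_simps power2_eq_square)
    have "real T powr (7/4) = real T * real T powr (3/4)"
      using powr_add[of "real T" 1 "3/4"] by simp
    then have "\<bar>(\<Sum>y=1..T. v y * c y) - pair_density s * real T ^ 2\<bar> \<le> (K1 + K2) * real T powr (7/4)"
      using m2 m3 by (simp add: algebra_simps)
    then show ?thesis using E unfolding sum_coprime_pairs v_def c_def by blast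
  qed
  have "K2 \<ge> 0" by (simp add: K2_def)
  show ?thesis
  proof (intro exI[of _ "K1 + K2"] conjI allI impI)
    fix s :: "nat \<Rightarrow> real" and T
    assume "admissible s"
    then have s: "\<forall>p. 0 \<le> s p \<and> s p \<le> 1 / real p" by (simp add: admissible_def)
    note m = main[of s T]
    show "\<bar>pair_density s\<bar> \<le> K1 + K2" using m s K1 by auto
    show "\<bar>(\<Sum>m=1..T. \<Sum>b\<in>coprime_pairs m. rad_prod (\<lambda>p. - s p) (snd b)) - pair_density s * real T ^ 2\<bar>
      \<le> (K1 + K2) * real T powr (7/4)" using m s by blast
  qed (use K1 \<open>K2 \<ge> 0\<close> in auto)
qed

section \<open>The sieve error averaged over coprime pairs\<close>

lemma sum_inverse_sqrt_le: "(\<Sum>m=1..N. real m powr (-1/2)) \<le> 2 * sqrt (real N)"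
proof (induction N)
  case (Suc N)
  have "real (Suc N) powr (-1/2) = 1 / sqrt (real (Suc N))"
    by (simp add: powr_minus_divide powr_half_sqrt)
  also have "\<dots> \<le> 2 * (sqrt (real (Suc N)) - sqrt (real N))"
  proof -
    define a b where "a = sqrt (real (Suc N))" and "b = sqrt (real N)"
    have ab: "a > 0" "b \<ge> 0" "a\<^sup>2 = b\<^sup>2 + 1" by (auto simp: a_def b_def)
    \<comment> \<open>Since \<open>a ^ 2 = b ^ 2 + 1\<close>, the two sides differ by
      \<open>(a - b) ^ 2\<close>.\<close>
    have "1 \<le> 2 * (a - b) * a"
      using ab sum_squares_ge_zero[of "a - b" 0] by (simp add: power2_eq_square algebra_simps)
    then show ?thesis using ab unfolding a_def[symmetric] b_def[symmetric]
      by (simp add: field_simps)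
  qed
  finally show ?case using Suc by simp
qed auto

text \<open>The inner sums have partial sums at most \<open>K * T * (T + 1)\<close>, those of
  \<open>2 * K * m\<close>, so Abel summation allows the replacement. The exponent -3/2 comes from
  the sieve error \<open>(B / (m * n) ^ 2) powr (3/4)\<close>; the exponent -2 is what is left for
  \<open>n\<close> once the sum over \<open>m\<close> has contributed
  \<open>n powr (-1/2)\<close>.\<close>

lemma sum_divisor_weight_coprime_pairs_le:
  "\<exists>C\<ge>0. \<forall>z\<ge>1.
    (\<Sum>m=1..nat \<lfloor>z\<rfloor>. (\<Sum>b\<in>coprime_pairs m. divisor_weight (snd b)) * real m powr (-3/2)) \<le> C * sqrt z \<and>
    (\<Sum>m=1..nat \<lfloor>z\<rfloor>. (\<Sum>b\<in>coprime_pairs m. divisor_weight (snd b)) * real m powr (-2)) \<le> C * (1 + ln z)"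
proof -
  obtain K where K: "K \<ge> 0" "\<And>T. (\<Sum>n=1..T. divisor_weight n) \<le> K * real T"
    using sum_divisor_weight_le by blast
  define \<rho> where "\<rho> = (\<lambda>m. \<Sum>b\<in>coprime_pairs m. divisor_weight (snd b))"
  have nn: "\<rho> m \<ge> 0" for m unfolding \<rho>_def by (intro sum_nonneg divisor_weight_nonneg)
  have S: "(\<Sum>m=1..T. \<rho> m) \<le> (\<Sum>m=1..T. 2 * K * real m)" for T
  proof -
    have "(\<Sum>m=1..T. \<rho> m) = (\<Sum>y=1..T. divisor_weight y * real (card {x\<in>{1..T}. coprime x y}))"
      unfolding \<rho>_def by (rule sum_coprime_pairs)
    also have "\<dots> \<le> (\<Sum>y=1..T. divisor_weight y * real T)"
    proof (intro sum_mono mult_left_mono)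
      fix y
      have "card {x\<in>{1..T}. coprime x y} \<le> card {1..T}" by (intro card_mono) auto
      then show "real (card {x\<in>{1..T}. coprime x y}) \<le> real T" by simp
    qed (rule divisor_weight_nonneg)
    also have "\<dots> \<le> K * real T * real T"
      unfolding sum_distrib_right[symmetric] by (intro mult_right_mono K) auto
    also have "\<dots> \<le> K * (real T * (real T + 1))" using K by (simp add: algebra_simps)
    also have "real T * (real T + 1) = (\<Sum>m=1..T. 2 * real m)"
      by (induction T) (auto simp: algebra_simps)
    finally show ?thesis by (simp add: sum_distrib_left mult_ac)
  qed
  have gen: "(\<Sum>m=1..N. \<rho> m * real m powr (- \<theta>)) \<le> (\<Sum>m=1..N. 2 * K * real m powr (1 - \<theta>))"
    if "\<theta> \<ge> 0" for N \<theta>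
  proof -
    have "\<bar>\<Sum>m=1..N. \<rho> m * real m powr (- \<theta>)\<bar> \<le> (\<Sum>m=1..N. (2 * K * real m) * real m powr (- \<theta>))"
    proof (rule abs_sum_mult_decreasing_le)
      show "\<bar>sum \<rho> {1..j}\<bar> \<le> (\<Sum>m = 1..j. 2 * K * real m)" for j
        using S[of j] nn by (simp add: sum_nonneg)
      show "real (Suc j) powr - \<theta> \<le> real j powr - \<theta>" if "j \<in> {1..<N}" for j
        using that \<open>\<theta> \<ge> 0\<close> by (intro powr_mono2') auto
    qed auto
    also have "\<dots> = (\<Sum>m=1..N. 2 * K * real m powr (1 - \<theta>))"
      by (intro sum.cong) (auto simp: powr_diff powr_minus_divide)
    finally show ?thesis by linarith
  qed
  show ?thesis
  proof (intro exI[of _ "4 * K"] conjI allI impI)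
    fix z :: real assume z: "z \<ge> 1"
    let ?N = "nat \<lfloor>z\<rfloor>"
    have N: "real ?N \<le> z" using z by (simp add: of_nat_floor)
    have "(\<Sum>m=1..?N. \<rho> m * real m powr (-3/2)) \<le> 2 * K * (\<Sum>m=1..?N. real m powr (-1/2))"
      using gen[of "3/2" ?N] by (simp add: sum_distrib_left)
    also have "\<dots> \<le> 2 * K * (2 * sqrt z)"
      using K order_trans[OF sum_inverse_sqrt_le[of ?N], of "2 * sqrt z"] real_sqrt_le_mono[OF N]
      by (intro mult_left_mono) auto
    finally show "(\<Sum>m=1..nat \<lfloor>z\<rfloor>. (\<Sum>b\<in>coprime_pairs m. divisor_weight (snd b)) * real m powr (-3/2)) \<le> 4 * K * sqrt z"
      by (simp add: \<rho>_def)
    have "(\<Sum>m=1..?N. \<rho> m * real m powr (-2)) \<le> 2 * K * (\<Sum>m=1..?N. 1 / real m)"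
      using gen[of 2 ?N] by (simp add: sum_distrib_left powr_minus_divide)
    also have "\<dots> \<le> 2 * K * (2 * (1 + ln z))"
    proof (rule mult_left_mono)
      have "ln z \<ge> 0" using z by simp
      then show "(\<Sum>m=1..?N. 1 / real m) \<le> 2 * (1 + ln z)"
        using sum_inverse_nat_floor_approx[OF z] unfolding abs_le_iff by argo
    qed (use K in auto)
    finally show "(\<Sum>m=1..nat \<lfloor>z\<rfloor>. (\<Sum>b\<in>coprime_pairs m. divisor_weight (snd b)) * real m powr (-2)) \<le> 4 * K * (1 + ln z)"
      by (simp add: \<rho>_def algebra_simps)
  qed (use K in auto)
qed

section \<open>Euler factors of the two densities\<close>

lemma pair_density_LIMSEQ:
  assumes "admissible s"
  shows "(\<lambda>N. \<Prod>p | prime p \<and> p \<le> N. 1 + ((1 - s p) * (1 - 1 / real p) - 1) / real p)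
    \<longlonglongrightarrow> pair_density s"
  unfolding pair_density_def
proof (rule LIMSEQ_euler_product)
  show "summable (\<lambda>p. \<bar>((1 - s p) * (1 - 1 / real p) - 1) / real p\<bar>)"
  proof (rule summable_comparison_test')
    show "summable (\<lambda>p. 2 * inverse (real p ^ 2))"
      by (intro summable_mult inverse_power_summable) simp
    fix p :: nat
    show "norm \<bar>((1 - s p) * (1 - 1 / real p) - 1) / real p\<bar> \<le> 2 * inverse (real p ^ 2)"
    proof -
      have "\<bar>(1 - s p) * (1 - 1 / real p) - 1\<bar> / real p \<le> (2 / real p) / real p"
        by (intro divide_right_mono abs_local_defect_le assms) auto
      also have "(2 / real p) / real p = 2 * inverse (real p ^ 2)"
        by (simp add: power2_eq_square divide_inverse)
      finally show ?thesis by simp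
    qed
  qed
qed

text \<open>With \<open>\<phi>\<close> the totient function, \<open>\<phi> (b * c) / (b * c)\<close> is \<open>\<phi> c / c\<close> times the product of
  \<open>1 - sieve_weight c p\<close> over the primes \<open>p\<close> dividing \<open>b\<close>. Averaging that product over the pairs
  containing \<open>b\<close> yields a function of \<open>c\<close> of the same shape, whose weight is \<open>avg_weight\<close>.\<close>

definition sieve_weight :: "nat \<Rightarrow> nat \<Rightarrow> real" where
  "sieve_weight c p = (if p \<in> prime_factors c then 0 else 1 / real p)"

definition avg_weight :: "nat \<Rightarrow> real" where
  "avg_weight p = (1 / real p) / (1 + 1 / real p - 1 / real p ^ 2)"

lemma avg_weight_denominator_ge_1:
  assumes "p > 0"
  shows "1 + 1 / real p - 1 / real p ^ 2 \<ge> 1"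
proof -
  have "1 / real p ^ 2 \<le> 1 / real p ^ 1"
    using assms by (intro divide_left_mono power_increasing) auto
  then show ?thesis by simp
qed

text \<open>This identity dictates the formula for \<open>avg_weight\<close>. Times
  \<open>1 - 1/p\<close>, the right side is the factor of
  \<open>pair_density (sieve_weight c) * tot_ratio c\<close> at a prime dividing \<open>c\<close>,
  while the first factor on the left becomes the Euler factor of \<open>pair_density\<close> for the
  weight \<open>1/p\<close>.\<close>

lemma one_minus_avg_weight:
  assumes "p > 0"
  shows "(1 + 1 / real p - 1 / real p ^ 2) * (1 - avg_weight p) = 1 - 1 / real p ^ 2"
proof -
  have "1 + 1 / real p - 1 / real p ^ 2 \<noteq> 0"
    using avg_weight_denominator_ge_1[OF assms] by linarith
  have "D * (1 - x / D) = D - x" if "D \<noteq> 0" for D x :: real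
    using that by (simp add: right_diff_distrib)
  from this[OF \<open>1 + _ - _ \<noteq> 0\<close>, of "1 / real p"] show ?thesis
    unfolding avg_weight_def by simp
qed

lemma local_factor_recip:
  "1 + ((1 - 1 / real p) * (1 - 1 / real p) - 1) / real p =
    (1 - 1 / real p) * (1 + 1 / real p - 1 / real p ^ 2)"
proof -
  have "1 + ((1 - x) * (1 - x) - 1) * x = (1 - x) * (1 + x - x ^ 2)" for x :: real
    by (simp add: algebra_simps power2_eq_square)
  from this[of "1 / real p"] show ?thesis by (simp add: power_divide)
qed

lemma admissible_weights:
  "admissible (\<lambda>p. 1 / real p)" "admissible (sieve_weight c)" "admissible avg_weight"
proof -
  show "admissible (\<lambda>p. 1 / real p)" "admissible (sieve_weight c)"
    by (auto simp: admissible_def sieve_weight_def)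
  have "0 \<le> avg_weight p \<and> avg_weight p \<le> 1 / real p" for p
  proof (cases "p = 0")
    case False
    have D: "1 + 1 / real p - 1 / real p ^ 2 \<ge> 1"
      using avg_weight_denominator_ge_1 False by simp
    have "(1 / real p) / (1 + 1 / real p - 1 / real p ^ 2) \<le> (1 / real p) / 1"
      using D by (intro divide_left_mono) auto
    then show ?thesis using D by (simp add: avg_weight_def)
  qed (simp add: avg_weight_def)
  then show "admissible avg_weight" by (simp add: admissible_def)
qed

text \<open>The primes of \<open>b * c\<close> are those of \<open>c\<close> together with those of
  \<open>b\<close> not dividing \<open>c\<close>; on the common primes \<open>sieve_weight c\<close>
  is 0.\<close>

lemma tot_ratio_mult:
  assumes "b > 0" "c > 0"
  shows "tot_ratio (b * c) = tot_ratio c * rad_prod (\<lambda>p. - sieve_weight c p) b"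
proof -
  have "tot_ratio (b * c) = (\<Prod>p\<in>prime_factors c \<union> prime_factors b. 1 - 1 / real p)"
    using assms by (simp add: tot_ratio_def rad_prod_def prime_factorization_mult Un_commute)
  also have "\<dots> = (\<Prod>p\<in>prime_factors c \<union> (prime_factors b - prime_factors c). 1 - 1 / real p)"
    by (rule prod.cong) auto
  also have "\<dots> = tot_ratio c * (\<Prod>p\<in>prime_factors b - prime_factors c. 1 - 1 / real p)"
    by (subst prod.union_disjoint) (auto simp: tot_ratio_def rad_prod_def)
  also have "(\<Prod>p\<in>prime_factors b - prime_factors c. 1 - 1 / real p) =
      rad_prod (\<lambda>p. - sieve_weight c p) b"
    unfolding rad_prod_def
    by (rule prod.mono_neutral_cong_left) (auto simp: sieve_weight_def)
  finally show ?thesis .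
qed

text \<open>The two products on the right overlap in the common primes of \<open>b\<close> and
  \<open>c\<close>, whose factors are at least 1.\<close>

lemma divisor_weight_mult_le:
  assumes "b > 0" "c > 0"
  shows "divisor_weight (b * c) \<le> divisor_weight b * divisor_weight c"
proof -
  let ?f = "\<lambda>p. 1 + 1 / real p powr (3/4)"
  have "divisor_weight b * divisor_weight c =
      (\<Prod>p\<in>prime_factors b \<union> prime_factors c. ?f p) * (\<Prod>p\<in>prime_factors b \<inter> prime_factors c. ?f p)"
    unfolding divisor_weight_def rad_prod_def by (rule prod.union_inter[symmetric]) auto
  also have "\<dots> \<ge> (\<Prod>p\<in>prime_factors b \<union> prime_factors c. ?f p) * 1"
    by (intro mult_left_mono prod_ge_1 prod_nonneg) (auto intro!: add_nonneg_nonneg)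
  also have "(\<Prod>p\<in>prime_factors b \<union> prime_factors c. ?f p) = divisor_weight (b * c)"
    using assms by (simp add: divisor_weight_def rad_prod_def prime_factorization_mult)
  finally show ?thesis by simp
qed

text \<open>The Euler products differ only at the primes of \<open>c\<close>, where
  \<open>tot_ratio c\<close> and \<open>avg_weight\<close> make up the discrepancy. The partial
  products agree exactly for \<open>N \<ge> c\<close>, since all primes of \<open>c\<close> then
  occur; the limit is taken afterwards.\<close>

lemma pair_density_sieve_weight:
  assumes c: "c > 0"
  shows "pair_density (sieve_weight c) * tot_ratio c =
    pair_density (\<lambda>p. 1 / real p) * rad_prod (\<lambda>p. - avg_weight p) c"
proof -
  define f where "f = (\<lambda>s p. 1 + ((1 - s p) * (1 - 1 / real p) - 1) / real p)"
  define P where "P = (\<lambda>N::nat. {p. prime p \<and> p \<le> N})"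
  have eq: "(\<Prod>p\<in>P N. f (sieve_weight c) p) * tot_ratio c =
      (\<Prod>p\<in>P N. f (\<lambda>p. 1 / real p) p) * rad_prod (\<lambda>p. - avg_weight p) c" if "N \<ge> c" for N
  proof -
    let ?A = "prime_factors c"
    have sub: "?A \<subseteq> P N" using c that
      by (auto simp: P_def in_prime_factors_iff dest!: dvd_imp_le)
    have fin: "finite (P N)" by (simp add: P_def)
    have "(\<Prod>p\<in>?A. f (sieve_weight c) p) * tot_ratio c =
        (\<Prod>p\<in>?A. f (sieve_weight c) p * (1 - 1 / real p))"
      by (simp add: tot_ratio_def rad_prod_def prod.distrib)
    also have "\<dots> = (\<Prod>p\<in>?A. f (\<lambda>p. 1 / real p) p * (1 + - avg_weight p))"
    proof (rule prod.cong[OF refl])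
      fix p assume p: "p \<in> ?A"
      have "p > 0" using p by (simp add: prime_factors_gt_0_nat)
      have "f (sieve_weight c) p = 1 - 1 / real p ^ 2"
        using p by (simp add: f_def sieve_weight_def power2_eq_square)
      then show "f (sieve_weight c) p * (1 - 1 / real p) = f (\<lambda>p. 1 / real p) p * (1 + - avg_weight p)"
        unfolding f_def local_factor_recip one_minus_avg_weight[OF \<open>p > 0\<close>, symmetric] by simp
    qed
    also have "\<dots> = (\<Prod>p\<in>?A. f (\<lambda>p. 1 / real p) p) * rad_prod (\<lambda>p. - avg_weight p) c"
      by (simp add: rad_prod_def prod.distrib)
    finally have A: "(\<Prod>p\<in>?A. f (sieve_weight c) p) * tot_ratio c = \<dots>" .
    have B: "(\<Prod>p\<in>P N - ?A. f (sieve_weight c) p) = (\<Prod>p\<in>P N - ?A. f (\<lambda>p. 1 / real p) p)"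
      by (rule prod.cong) (auto simp: f_def sieve_weight_def)
    show ?thesis
      unfolding prod.subset_diff[OF sub fin] B using A by simp
  qed
  have "(\<lambda>N. (\<Prod>p\<in>P N. f (sieve_weight c) p) * tot_ratio c) \<longlonglongrightarrow> pair_density (sieve_weight c) * tot_ratio c"
    unfolding f_def P_def by (intro tendsto_mult_right pair_density_LIMSEQ admissible_weights)
  moreover have "(\<lambda>N. (\<Prod>p\<in>P N. f (\<lambda>p. 1 / real p) p) * rad_prod (\<lambda>p. - avg_weight p) c) \<longlonglongrightarrow>
      pair_density (\<lambda>p. 1 / real p) * rad_prod (\<lambda>p. - avg_weight p) c"
    unfolding f_def P_def by (intro tendsto_mult_right pair_density_LIMSEQ admissible_weights)
  moreover have "\<forall>\<^sub>F N in sequentially. (\<Prod>p\<in>P N. f (sieve_weight c) p) * tot_ratio c =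
      (\<Prod>p\<in>P N. f (\<lambda>p. 1 / real p) p) * rad_prod (\<lambda>p. - avg_weight p) c"
    using eventually_ge_at_top[of c] by eventually_elim (rule eq)
  ultimately show ?thesis
    using LIMSEQ_unique tendsto_cong by fast
qed

text \<open>The identity holds prime by prime for the partial products, and both sides
  converge.\<close>

lemma pair_density_mult_eq_prodinf:
  "pair_density (\<lambda>p. 1 / real p) * pair_density avg_weight =
    (\<Prod>p. if prime p then euler_factor p else 1)"
proof -
  define f where "f = (\<lambda>s p. 1 + ((1 - s p) * (1 - 1 / real p) - 1) / real p)"
  define P where "P = (\<lambda>N::nat. {p. prime p \<and> p \<le> N})"
  have "(\<lambda>N. (\<Prod>p\<in>P N. f (\<lambda>p. 1 / real p) p) * (\<Prod>p\<in>P N. f avg_weight p)) \<longlonglongrightarrow>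
      pair_density (\<lambda>p. 1 / real p) * pair_density avg_weight"
    unfolding f_def P_def by (intro tendsto_mult pair_density_LIMSEQ admissible_weights)
  moreover have "(\<Prod>p\<in>P N. f (\<lambda>p. 1 / real p) p) * (\<Prod>p\<in>P N. f avg_weight p) =
      (\<Prod>p\<le>N. if prime p then euler_factor p else 1)" for N
  proof -
    have "(\<Prod>p\<in>P N. f (\<lambda>p. 1 / real p) p) * (\<Prod>p\<in>P N. f avg_weight p) = (\<Prod>p\<in>P N. euler_factor p)"
      unfolding prod.distrib[symmetric]
    proof (rule prod.cong[OF refl])
      fix p assume p: "p \<in> P N"
      have "p > 0" using p by (auto simp: P_def prime_gt_0_nat)
      define x where "x = 1 / real p"
      have 1: "f (\<lambda>p. 1 / real p) p = (1 - x) * (1 + x - x ^ 2)"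
        unfolding f_def local_factor_recip by (simp add: x_def power_divide)
      have a: "(1 + x - x ^ 2) * (1 - avg_weight p) = 1 - x ^ 2"
        using one_minus_avg_weight[OF \<open>p > 0\<close>] by (simp add: x_def power_divide)
      have "f avg_weight p = 1 + ((1 - avg_weight p) * (1 - x) - 1) * x" by (simp add: f_def x_def)
      \<comment> \<open>The denominator of \<open>avg_weight\<close> is a factor of the Euler factor
        of the first density; multiplying by it keeps the computation polynomial in
        \<open>x\<close>.\<close>
      then have "(1 + x - x ^ 2) * f avg_weight p =
          (1 + x - x ^ 2) * (1 - x) + (1 + x - x ^ 2) * (1 - avg_weight p) * (1 - x) * x"
        by algebra
      then have 2: "(1 + x - x ^ 2) * f avg_weight p =
          (1 + x - x ^ 2) * (1 - x) + (1 - x ^ 2) * (1 - x) * x"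
        unfolding a .
      have "f (\<lambda>p. 1 / real p) p * f avg_weight p =
          (1 - x) * ((1 + x - x ^ 2) * (1 - x) + (1 - x ^ 2) * (1 - x) * x)"
        unfolding 1 mult.assoc 2 ..
      also have "\<dots> = (1 - x)\<^sup>2 * (1 + 2 * x - x ^ 2 - x ^ 3)"
        by (simp add: algebra_simps power2_eq_square power3_eq_cube)
      also have "\<dots> = euler_factor p"
        by (simp add: euler_factor_def x_def power_divide)
      finally show "f (\<lambda>p. 1 / real p) p * f avg_weight p = euler_factor p" .
    qed
    also have "\<dots> = (\<Prod>p\<le>N. if prime p then euler_factor p else 1)"
      by (rule prod.mono_neutral_cong_left) (auto simp: P_def)
    finally show ?thesis .
  qed
  moreover have "(\<lambda>N. \<Prod>p\<le>N. if prime p then euler_factor p else 1) \<longlonglongrightarrow>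
      (\<Prod>p. if prime p then euler_factor p else 1)"
    by (rule convergent_prod_LIMSEQ[OF convergent_prod_euler_factor])
  ultimately show ?thesis using LIMSEQ_unique by auto
qed

text \<open>Partial summation with \<open>r m\<close> the total weight of the pairs of maximum
  \<open>m\<close>. A single constant has to serve all admissible \<open>s\<close>, since the
  estimate is applied to \<open>sieve_weight (snd c)\<close> for every \<open>c\<close>.\<close>

lemma sum_coprime_pairs_div_square:
  "\<exists>C\<ge>0. \<forall>s. admissible s \<longrightarrow> \<bar>pair_density s\<bar> \<le> C \<and>
    (\<forall>z\<ge>1. \<bar>(\<Sum>m=1..nat \<lfloor>z\<rfloor>. (\<Sum>b\<in>coprime_pairs m. rad_prod (\<lambda>p. - s p) (snd b)) / real m ^ 2)
      - 2 * pair_density s * ln z\<bar> \<le> C)"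
proof -
  obtain C where C: "C \<ge> 0" "\<And>s. admissible s \<Longrightarrow> \<bar>pair_density s\<bar> \<le> C"
    "\<And>s T. admissible s \<Longrightarrow>
      \<bar>(\<Sum>m=1..T. \<Sum>b\<in>coprime_pairs m. rad_prod (\<lambda>p. - s p) (snd b)) - pair_density s * real T ^ 2\<bar>
      \<le> C * real T powr (7/4)"
    using coprime_pairs_approx by blast
  define Z where "Z = (\<Sum>m. real m powr (-5/4))"
  have Z: "Z \<ge> 0" unfolding Z_def by (intro suminf_nonneg) (auto simp: summable_real_powr_iff)
  define K where "K = 2 * (C + C) * Z + 2 * C"
  show ?thesis
  proof (intro exI[of _ "K + C"] conjI allI impI)
    show "K + C \<ge> 0" using C Z by (simp add: K_def)
    fix s assume s: "admissible s"
    show "\<bar>pair_density s\<bar> \<le> K + C" using C(1) C(2)[OF s] mult_nonneg_nonneg[OF C(1) Z] by (simp add: K_def)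
    fix z :: real assume z: "z \<ge> 1"
    have "\<bar>(\<Sum>m=1..nat \<lfloor>z\<rfloor>. (\<Sum>b\<in>coprime_pairs m. rad_prod (\<lambda>p. - s p) (snd b)) / real m ^ 2)
      - 2 * pair_density s * ln z\<bar> \<le> 2 * (C + \<bar>pair_density s\<bar>) * Z + 2 * \<bar>pair_density s\<bar>"
      unfolding Z_def by (rule sum_div_square_approx_ln[OF C(3)[OF s] z])
    also have "\<dots> \<le> K" unfolding K_def using C(1) C(2)[OF s] Z
      by (intro add_mono mult_mono) auto
    also have "\<dots> \<le> K + C" using C by simp
    finally show "\<bar>(\<Sum>m=1..nat \<lfloor>z\<rfloor>. (\<Sum>b\<in>coprime_pairs m. rad_prod (\<lambda>p. - s p) (snd b)) / real m ^ 2)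
      - 2 * pair_density s * ln z\<bar> \<le> K + C" .
  qed
qed

section \<open>Summation over the fibres\<close>

text \<open>The pairs \<open>b\<close> and \<open>c\<close> stand for \<open>(\<bar>b\<^sub>0\<bar>, \<bar>b\<^sub>1\<bar>)\<close> and \<open>(\<bar>c\<^sub>0\<bar>, \<bar>c\<^sub>1\<bar>)\<close>, of maximum \<open>m\<close> and \<open>n\<close>,
  and \<open>a\<close> for \<open>\<bar>a\<^sub>1\<bar>\<close>.\<close>

definition torsor_count :: "real \<Rightarrow> nat" where
  "torsor_count B = (\<Sum>n=1..nat \<lfloor>sqrt B\<rfloor>. \<Sum>c\<in>coprime_pairs n.
     \<Sum>m=1..nat \<lfloor>sqrt B / real n\<rfloor>. \<Sum>b\<in>coprime_pairs m.
       card {a\<in>{1..nat \<lfloor>B / (real m * real n)\<^sup>2\<rfloor>}. coprime a (snd b * snd c)})"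

lemma le_nat_floorD:
  assumes "n \<in> {1..nat \<lfloor>x\<rfloor>}"
  shows "n \<ge> 1" "real n \<le> x"
proof -
  have "int n \<le> \<lfloor>x\<rfloor>" using assms by auto
  then show "real n \<le> x" by (simp add: le_floor_iff)
qed (use assms in auto)

lemma coprime_pairs_snd_pos: "b \<in> coprime_pairs m \<Longrightarrow> snd b > 0"
  by (auto simp: coprime_pairs_def)

text \<open>Each choice of \<open>b\<close> and \<open>c\<close> costs
  \<open>B powr (3/4) * (m * n) powr (-3/2)\<close> times the two divisor weights. With
  \<open>Y = sqrt B\<close>, the sum over \<open>m\<close> gives \<open>sqrt (Y / n)\<close>, which
  leaves \<open>n powr (-2)\<close> and hence a single logarithm from the sum over \<open>n\<close>;
  the exponents of \<open>B\<close> add up to \<open>3/4 + 1/4\<close>.\<close>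

lemma torsor_count_fibre_error:
  "\<exists>C\<ge>0. \<forall>B\<ge>1. \<bar>real (torsor_count B) -
    (\<Sum>n=1..nat \<lfloor>sqrt B\<rfloor>. \<Sum>c\<in>coprime_pairs n.
       \<Sum>m=1..nat \<lfloor>sqrt B / real n\<rfloor>. \<Sum>b\<in>coprime_pairs m.
         B / (real m * real n)\<^sup>2 * tot_ratio (snd b * snd c))\<bar> \<le> C * (B * (1 + ln B))"
proof -
  define \<rho> where "\<rho> = (\<lambda>m. \<Sum>b\<in>coprime_pairs m. divisor_weight (snd b))"
  obtain C where C: "C \<ge> 0" and
    C1: "\<And>z. z \<ge> 1 \<Longrightarrow> (\<Sum>m=1..nat \<lfloor>z\<rfloor>. \<rho> m * real m powr (-3/2)) \<le> C * sqrt z" and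
    C2: "\<And>z. z \<ge> 1 \<Longrightarrow> (\<Sum>m=1..nat \<lfloor>z\<rfloor>. \<rho> m * real m powr (-2)) \<le> C * (1 + ln z)"
    using sum_divisor_weight_coprime_pairs_le unfolding \<rho>_def by blast
  have \<rho>0: "\<rho> m \<ge> 0" for m unfolding \<rho>_def by (intro sum_nonneg divisor_weight_nonneg)
  show ?thesis
  proof (intro exI[of _ "C * C"] conjI allI impI)
    fix B :: real assume B: "B \<ge> 1"
    define Y where "Y = sqrt B"
    have Y: "Y \<ge> 1" using B by (simp add: Y_def)
    define g where "g = (\<lambda>(n::nat) (c::nat \<times> nat) (m::nat) (b::nat \<times> nat). real (card {a\<in>{1..nat \<lfloor>B / (real m * real n)\<^sup>2\<rfloor>}. coprime a (snd b * snd c)})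
       - B / (real m * real n)\<^sup>2 * tot_ratio (snd b * snd c))"
    have g: "\<bar>g n c m b\<bar> \<le> B powr (3/4) * real n powr (-3/2) * real m powr (-3/2)
        * (divisor_weight (snd b) * divisor_weight (snd c))"
      if "b \<in> coprime_pairs m" "c \<in> coprime_pairs n" "m \<ge> 1" "n \<ge> 1" for n c m b
    proof -
      have pos: "snd b > 0" "snd c > 0" using that coprime_pairs_snd_pos by auto
      have "\<bar>g n c m b\<bar> \<le> (B / (real m * real n)\<^sup>2) powr (3/4) * divisor_weight (snd b * snd c)"
        unfolding g_def using pos B by (intro card_coprime_approx) auto
      also have "\<dots> \<le> (B / (real m * real n)\<^sup>2) powr (3/4) * (divisor_weight (snd b) * divisor_weight (snd c))"
        using pos by (intro mult_left_mono divisor_weight_mult_le) auto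
      also have "(B / (real m * real n)\<^sup>2) powr (3/4) = B powr (3/4) * real n powr (-3/2) * real m powr (-3/2)"
      proof -
        have sq: "(x\<^sup>2) powr (3/4) = x powr (3/2)" if "x > 0" for x :: real
          using that powr_powr[of x 2 "3/4"] by simp
        have "(B / (real m * real n)\<^sup>2) powr (3/4) = B powr (3/4) / ((real m * real n) powr (3/2))"
          using B that by (simp add: powr_divide sq)
        also have "\<dots> = B powr (3/4) * real n powr (-3/2) * real m powr (-3/2)"
          by (simp add: powr_mult powr_minus_divide)
        finally show ?thesis .
      qed
      finally show ?thesis .
    qed
    have eq: "real (torsor_count B) -
        (\<Sum>n=1..nat \<lfloor>Y\<rfloor>. \<Sum>c\<in>coprime_pairs n. \<Sum>m=1..nat \<lfloor>Y / real n\<rfloor>. \<Sum>b\<in>coprime_pairs m.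
         B / (real m * real n)\<^sup>2 * tot_ratio (snd b * snd c)) =
        (\<Sum>n=1..nat \<lfloor>Y\<rfloor>. \<Sum>c\<in>coprime_pairs n. \<Sum>m=1..nat \<lfloor>Y / real n\<rfloor>. \<Sum>b\<in>coprime_pairs m. g n c m b)"
      unfolding torsor_count_def g_def Y_def by (simp add: sum_subtractf)
    have "\<bar>\<Sum>n=1..nat \<lfloor>Y\<rfloor>. \<Sum>c\<in>coprime_pairs n. \<Sum>m=1..nat \<lfloor>Y / real n\<rfloor>. \<Sum>b\<in>coprime_pairs m. g n c m b\<bar>
        \<le> (\<Sum>n=1..nat \<lfloor>Y\<rfloor>. \<Sum>c\<in>coprime_pairs n. \<Sum>m=1..nat \<lfloor>Y / real n\<rfloor>. \<Sum>b\<in>coprime_pairs m.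
          B powr (3/4) * real n powr (-3/2) * real m powr (-3/2) * (divisor_weight (snd b) * divisor_weight (snd c)))"
      by (intro order_trans[OF sum_abs] sum_mono g) auto
    also have "\<dots> = B powr (3/4) * (\<Sum>n=1..nat \<lfloor>Y\<rfloor>. \<rho> n * real n powr (-3/2) *
        (\<Sum>m=1..nat \<lfloor>Y / real n\<rfloor>. \<rho> m * real m powr (-3/2)))"
    proof -
      have "(\<Sum>c\<in>coprime_pairs n. \<Sum>m=1..nat \<lfloor>Y / real n\<rfloor>. \<Sum>b\<in>coprime_pairs m.
          B powr (3/4) * real n powr (-3/2) * real m powr (-3/2) * (divisor_weight (snd b) * divisor_weight (snd c)))
         = B powr (3/4) * (\<rho> n * real n powr (-3/2) * (\<Sum>m=1..nat \<lfloor>Y / real n\<rfloor>. \<rho> m * real m powr (-3/2)))" for n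
        unfolding \<rho>_def by (subst sum.swap) (simp add: sum_distrib_left sum_distrib_right mult_ac)
      then show ?thesis by (simp add: sum_distrib_left)
    qed
    also have "\<dots> \<le> B powr (3/4) * (\<Sum>n=1..nat \<lfloor>Y\<rfloor>. C * sqrt Y * (\<rho> n * real n powr (-2)))"
    proof (intro mult_left_mono sum_mono)
      fix n assume "n \<in> {1..nat \<lfloor>Y\<rfloor>}"
      then have n: "n \<ge> 1" "real n \<le> Y" using le_nat_floorD by auto
      then have "Y / real n \<ge> 1" by simp
      from C1[OF this] have "\<rho> n * real n powr (-3/2) * (\<Sum>m=1..nat \<lfloor>Y / real n\<rfloor>. \<rho> m * real m powr (-3/2))
          \<le> \<rho> n * real n powr (-3/2) * (C * sqrt (Y / real n))"
        using \<rho>0 by (intro mult_left_mono) auto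
      also have "\<dots> = C * sqrt Y * (\<rho> n * (real n powr (-3/2) * real n powr (-1/2)))"
        by (simp add: real_sqrt_divide powr_minus_divide powr_half_sqrt)
      also have "real n powr (-3/2) * real n powr (-1/2) = real n powr (-2)"
        by (simp add: powr_add[symmetric])
      finally show "\<rho> n * real n powr (-3/2) * (\<Sum>m=1..nat \<lfloor>Y / real n\<rfloor>. \<rho> m * real m powr (-3/2))
          \<le> C * sqrt Y * (\<rho> n * real n powr (-2))" .
    qed auto
    also have "\<dots> = B powr (3/4) * (C * sqrt Y) * (\<Sum>n=1..nat \<lfloor>Y\<rfloor>. \<rho> n * real n powr (-2))"
      by (simp only: sum_distrib_left mult.assoc)
    also have "\<dots> \<le> B powr (3/4) * (C * sqrt Y) * (C * (1 + ln Y))"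
      using C Y by (intro mult_left_mono C2) auto
    also have "\<dots> = (B powr (3/4) * B powr (1/4)) * (C * C * (1 + ln Y))"
    proof -
      have "sqrt Y = B powr (1/4)"
        using B unfolding Y_def by (simp add: powr_half_sqrt[symmetric] powr_powr)
      then show ?thesis by simp
    qed
    also have "\<dots> = B * (C * C * (1 + ln Y))" using B by (simp add: powr_add[symmetric])
    also have "\<dots> \<le> B * (C * C * (1 + ln B))"
      using B C unfolding Y_def by (intro mult_left_mono) (auto simp: ln_sqrt)
    finally show "\<bar>real (torsor_count B) -
      (\<Sum>n=1..nat \<lfloor>sqrt B\<rfloor>. \<Sum>c\<in>coprime_pairs n.
         \<Sum>m=1..nat \<lfloor>sqrt B / real n\<rfloor>. \<Sum>b\<in>coprime_pairs m.
           B / (real m * real n)\<^sup>2 * tot_ratio (snd b * snd c))\<bar> \<le> C * C * (B * (1 + ln B))"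
      unfolding eq[unfolded Y_def] by (simp add: Y_def mult_ac)
  qed (use C in auto)
qed

text \<open>For fixed \<open>c\<close> the sum over \<open>b\<close> is
  \<open>2 * pair_density (sieve_weight (snd c)) * ln (Y / n)\<close> up to an error bounded
  uniformly in \<open>c\<close>. Multiplication by \<open>tot_ratio (snd c)\<close> turns the
  density into a constant times a product with \<open>avg_weight\<close>, so the sum over
  \<open>c\<close> is a logarithmically weighted sum of the same kind.\<close>

lemma torsor_count_main_term:
  "\<exists>C\<ge>0. \<forall>B\<ge>1. \<bar>(\<Sum>n=1..nat \<lfloor>sqrt B\<rfloor>. \<Sum>c\<in>coprime_pairs n.
       \<Sum>m=1..nat \<lfloor>sqrt B / real n\<rfloor>. \<Sum>b\<in>coprime_pairs m.
         B / (real m * real n)\<^sup>2 * tot_ratio (snd b * snd c))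
     - pair_density (\<lambda>p. 1 / real p) * pair_density avg_weight / 2 * (B * (ln B)\<^sup>2)\<bar> \<le> C * (B * (1 + ln B))"
proof -
  let ?E0 = "pair_density (\<lambda>p. 1 / real p)" and ?E2 = "pair_density avg_weight"
  let ?S = "\<lambda>s m. (\<Sum>b\<in>coprime_pairs m. rad_prod (\<lambda>p. - s p) (snd b)) / real m ^ 2"
  obtain C where CC: "C \<ge> 0 \<and> (\<forall>s. admissible s \<longrightarrow> \<bar>pair_density s\<bar> \<le> C \<and>
      (\<forall>z\<ge>1. \<bar>(\<Sum>m=1..nat \<lfloor>z\<rfloor>. ?S s m) - 2 * pair_density s * ln z\<bar> \<le> C))"
    using sum_coprime_pairs_div_square ..
  note C = CC[THEN conjunct1] CC[THEN conjunct2, rule_format, THEN conjunct1]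
    CC[THEN conjunct2, rule_format, THEN conjunct2, rule_format]
  have tot0: "tot_ratio n \<ge> 0" for n
    unfolding tot_ratio_def
    by (rule rad_prod_nonneg) (auto dest: prime_ge_1_nat)
  define K where "K = 2 * C * ((C + 2 * C) + 2 * (2 * C)) + C * (2 * C + C)"
  show ?thesis
  proof (intro exI[of _ K] conjI allI impI)
    show "K \<ge> 0" using C(1) by (simp add: K_def)
    fix B :: real assume B: "B \<ge> 1"
    define Y where "Y = sqrt B"
    have Y: "Y \<ge> 1" using B by (simp add: Y_def)
    have lnY: "ln Y \<ge> 0" "ln Y = ln B / 2" using Y B by (auto simp: Y_def ln_sqrt)
    define M where "M = (\<Sum>n=1..nat \<lfloor>Y\<rfloor>. \<Sum>c\<in>coprime_pairs n.
        tot_ratio (snd c) / real n ^ 2 * (\<Sum>m=1..nat \<lfloor>Y / real n\<rfloor>. ?S (sieve_weight (snd c)) m))"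
    have main_eq: "(\<Sum>n=1..nat \<lfloor>Y\<rfloor>. \<Sum>c\<in>coprime_pairs n.
       \<Sum>m=1..nat \<lfloor>Y / real n\<rfloor>. \<Sum>b\<in>coprime_pairs m.
         B / (real m * real n)\<^sup>2 * tot_ratio (snd b * snd c)) = B * M"
    proof -
      have inner: "(\<Sum>m=1..nat \<lfloor>Y / real n\<rfloor>. \<Sum>b\<in>coprime_pairs m.
          B / (real m * real n)\<^sup>2 * tot_ratio (snd b * snd c)) =
          B * (tot_ratio (snd c) / real n ^ 2 * (\<Sum>m=1..nat \<lfloor>Y / real n\<rfloor>. ?S (sieve_weight (snd c)) m))"
        if c: "c \<in> coprime_pairs n" for n c
      proof -
        have "(\<Sum>b\<in>coprime_pairs m. B / (real m * real n)\<^sup>2 * tot_ratio (snd b * snd c)) =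
            B * (tot_ratio (snd c) / real n ^ 2 * ?S (sieve_weight (snd c)) m)" for m
        proof -
          have "B / (real m * real n)\<^sup>2 * tot_ratio (snd b * snd c) =
              B * tot_ratio (snd c) / (real m ^ 2 * real n ^ 2) * rad_prod (\<lambda>p. - sieve_weight (snd c) p) (snd b)"
            if "b \<in> coprime_pairs m" for b
            using tot_ratio_mult[of "snd b" "snd c"] coprime_pairs_snd_pos[OF c] coprime_pairs_snd_pos[OF that]
            by (simp add: power_mult_distrib)
          then have "(\<Sum>b\<in>coprime_pairs m. B / (real m * real n)\<^sup>2 * tot_ratio (snd b * snd c)) =
              B * tot_ratio (snd c) / (real m ^ 2 * real n ^ 2) *
              (\<Sum>b\<in>coprime_pairs m. rad_prod (\<lambda>p. - sieve_weight (snd c) p) (snd b))"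
            by (simp add: sum_distrib_left)
          then show ?thesis by (simp add: mult_ac)
        qed
        then show ?thesis by (simp only: sum_distrib_left)
      qed
      have "B * M = (\<Sum>n=1..nat \<lfloor>Y\<rfloor>. \<Sum>c\<in>coprime_pairs n. B *
          (tot_ratio (snd c) / real n ^ 2 * (\<Sum>m=1..nat \<lfloor>Y / real n\<rfloor>. ?S (sieve_weight (snd c)) m)))"
        unfolding M_def by (simp only: sum_distrib_left)
      then show ?thesis
        by (simp only:) (rule sum.cong[OF refl], rule sum.cong[OF refl], rule inner)
    qed
    \<comment> \<open>The sum over \<open>b\<close> is replaced by its asymptotic value.\<close>
    define M1 where "M1 = (\<Sum>n=1..nat \<lfloor>Y\<rfloor>. \<Sum>c\<in>coprime_pairs n.
        tot_ratio (snd c) / real n ^ 2 * (2 * pair_density (sieve_weight (snd c)) * ln (Y / real n)))"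
    have "\<bar>M - M1\<bar> \<le> (\<Sum>n=1..nat \<lfloor>Y\<rfloor>. \<Sum>c\<in>coprime_pairs n. tot_ratio (snd c) / real n ^ 2 * C)"
    proof -
      have "M - M1 = (\<Sum>n=1..nat \<lfloor>Y\<rfloor>. \<Sum>c\<in>coprime_pairs n. tot_ratio (snd c) / real n ^ 2 *
        ((\<Sum>m=1..nat \<lfloor>Y / real n\<rfloor>. ?S (sieve_weight (snd c)) m) - 2 * pair_density (sieve_weight (snd c)) * ln (Y / real n)))"
        unfolding M_def M1_def by (simp only: sum_subtractf right_diff_distrib)
      also have "\<bar>\<dots>\<bar> \<le> (\<Sum>n=1..nat \<lfloor>Y\<rfloor>. \<Sum>c\<in>coprime_pairs n. tot_ratio (snd c) / real n ^ 2 * C)"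
      proof (intro order_trans[OF sum_abs] sum_mono)
        fix n c assume "n \<in> {1..nat \<lfloor>Y\<rfloor>}"
        then have n: "n \<ge> 1" "real n \<le> Y" using le_nat_floorD by auto
        then have z: "Y / real n \<ge> 1" by simp
        show "\<bar>tot_ratio (snd c) / real n ^ 2 *
          ((\<Sum>m=1..nat \<lfloor>Y / real n\<rfloor>. ?S (sieve_weight (snd c)) m) - 2 * pair_density (sieve_weight (snd c)) * ln (Y / real n))\<bar>
          \<le> tot_ratio (snd c) / real n ^ 2 * C"
          using C(3)[OF admissible_weights(2) z, of "snd c"] tot0[of "snd c"]
          by (simp only: abs_mult, intro mult_mono) (auto simp: abs_if)
      qed
      finally show ?thesis .
    qed
    \<comment> \<open>As \<open>tot_ratio\<close> is the weight with \<open>s p = 1/p\<close>, the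
      same estimate bounds the accumulated error by a single logarithm.\<close>
    also have "\<dots> = C * (\<Sum>n=1..nat \<lfloor>Y\<rfloor>. ?S (\<lambda>p. 1 / real p) n)"
      by (simp add: sum_distrib_left sum_divide_distrib tot_ratio_def mult_ac)
    also have "\<dots> \<le> C * (2 * C * ln Y + C)"
    proof (rule mult_left_mono)
      have "2 * ?E0 * ln Y \<le> 2 * C * ln Y"
        using C(2)[OF admissible_weights(1)] lnY by (intro mult_right_mono) auto
      then show "(\<Sum>n=1..nat \<lfloor>Y\<rfloor>. ?S (\<lambda>p. 1 / real p) n) \<le> 2 * C * ln Y + C"
        using C(3)[OF admissible_weights(1) Y] unfolding abs_le_iff by argo
    qed (rule C)
    finally have 1: "\<bar>M - M1\<bar> \<le> C * (2 * C * ln Y + C)" .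
    have M1: "M1 = 2 * ?E0 * (\<Sum>n=1..nat \<lfloor>Y\<rfloor>. ?S avg_weight n * ln (Y / real n))"
    proof -
      have "(\<Sum>c\<in>coprime_pairs n. tot_ratio (snd c) / real n ^ 2 * (2 * pair_density (sieve_weight (snd c)) * ln (Y / real n)))
        = 2 * ?E0 * (?S avg_weight n * ln (Y / real n))" for n
      proof -
        have "(\<Sum>c\<in>coprime_pairs n. tot_ratio (snd c) / real n ^ 2 * (2 * pair_density (sieve_weight (snd c)) * ln (Y / real n)))
          = (\<Sum>c\<in>coprime_pairs n. 2 * ?E0 * (rad_prod (\<lambda>p. - avg_weight p) (snd c) / real n ^ 2 * ln (Y / real n)))"
        proof (rule sum.cong[OF refl])
          fix c assume "c \<in> coprime_pairs n"
          note e = pair_density_sieve_weight[OF coprime_pairs_snd_pos[OF this]]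
          have "tot_ratio (snd c) / real n ^ 2 * (2 * pair_density (sieve_weight (snd c)) * ln (Y / real n)) =
            2 * (pair_density (sieve_weight (snd c)) * tot_ratio (snd c)) / real n ^ 2 * ln (Y / real n)"
            by simp
          also have "\<dots> = 2 * ?E0 * (rad_prod (\<lambda>p. - avg_weight p) (snd c) / real n ^ 2 * ln (Y / real n))"
            unfolding e by simp
          finally show "tot_ratio (snd c) / real n ^ 2 * (2 * pair_density (sieve_weight (snd c)) * ln (Y / real n)) = \<dots>" .
        qed
        also have "\<dots> = 2 * ?E0 * (?S avg_weight n * ln (Y / real n))"
          by (simp only: sum_distrib_left sum_distrib_right sum_divide_distrib)
        finally show ?thesis .
      qed
      then show ?thesis unfolding M1_def by (simp only: sum_distrib_left)
    qed
    \<comment> \<open>Here \<open>\<kappa> = 2 * ?E2\<close>. Since \<open>ln Y = ln B / 2\<close>,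
      the main term \<open>2 * ?E0 * ?E2 * (ln Y) ^ 2\<close> becomes
      \<open>?E0 * ?E2 / 2 * (ln B) ^ 2\<close>.\<close>
    have "\<bar>(\<Sum>n=1..nat \<lfloor>Y\<rfloor>. ?S avg_weight n * ln (Y / real n)) - 2 * ?E2 / 2 * (ln Y)\<^sup>2\<bar>
        \<le> (C + \<bar>2 * ?E2\<bar>) * ln Y + \<bar>2 * ?E2\<bar> * (ln Y + 1)"
    proof (rule sum_mult_ln_approx[OF _ Y])
      fix j :: nat assume "j \<ge> 1"
      then show "\<bar>(\<Sum>m=1..j. ?S avg_weight m) - 2 * ?E2 * ln (real j)\<bar> \<le> C"
        using C(3)[OF admissible_weights(3), of "real j"] by simp
    qed
    also have "\<dots> \<le> (C + 2 * C) * ln Y + 2 * C * (ln Y + 1)"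
      using C(1) C(2)[OF admissible_weights(3)] lnY by (intro add_mono mult_right_mono) auto
    also have "\<dots> \<le> (C + 2 * C) * (1 + ln B) + 2 * (2 * C) * (1 + ln B)"
      using C(1) lnY by (intro add_mono[OF mult_mono mult_mono]) auto
    finally have 2: "\<bar>(\<Sum>n=1..nat \<lfloor>Y\<rfloor>. ?S avg_weight n * ln (Y / real n)) - ?E2 * (ln Y)\<^sup>2\<bar>
        \<le> ((C + 2 * C) + 2 * (2 * C)) * (1 + ln B)" by (simp add: algebra_simps)
    have "\<bar>2 * ?E0 * ((\<Sum>n=1..nat \<lfloor>Y\<rfloor>. ?S avg_weight n * ln (Y / real n)) - ?E2 * (ln Y)\<^sup>2)\<bar>
        \<le> 2 * C * (((C + 2 * C) + 2 * (2 * C)) * (1 + ln B))"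
      unfolding abs_mult using C(2)[OF admissible_weights(1)] 2 C(1) by (intro mult_mono) auto
    then have 3: "\<bar>M1 - ?E0 * ?E2 / 2 * (ln B)\<^sup>2\<bar> \<le> 2 * C * (((C + 2 * C) + 2 * (2 * C)) * (1 + ln B))"
    proof -
      have "2 * ?E0 * ((\<Sum>n=1..nat \<lfloor>Y\<rfloor>. ?S avg_weight n * ln (Y / real n)) - ?E2 * (ln Y)\<^sup>2) =
          M1 - ?E0 * ?E2 / 2 * (ln B)\<^sup>2"
        unfolding M1 right_diff_distrib lnY(2) by (simp add: power2_eq_square)
      then show ?thesis using \<open>\<bar>2 * ?E0 * (_ - _)\<bar> \<le> _\<close> by simp
    qed
    have "C * (2 * C * ln Y + C) \<le> C * (2 * C + C) * (1 + ln B)"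
    proof -
      have "2 * C * ln Y + C \<le> 2 * C * (1 + ln B) + C * (1 + ln B)"
        using C(1) lnY by (intro add_mono mult_left_mono) (auto simp: mult_le_cancel_left1)
      from mult_left_mono[OF this C(1)] show ?thesis by (simp add: algebra_simps)
    qed
    then have "\<bar>M - ?E0 * ?E2 / 2 * (ln B)\<^sup>2\<bar> \<le> K * (1 + ln B)"
      using 1 3 unfolding K_def distrib_right mult.assoc by linarith
    then have "\<bar>B * (M - ?E0 * ?E2 / 2 * (ln B)\<^sup>2)\<bar> \<le> B * (K * (1 + ln B))"
      unfolding abs_mult using B by (intro mult_mono) auto
    then have "\<bar>B * M - ?E0 * ?E2 / 2 * (B * (ln B)\<^sup>2)\<bar> \<le> K * (B * (1 + ln B))"
      by (simp add: right_diff_distrib mult_ac)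
    then show "\<bar>(\<Sum>n=1..nat \<lfloor>sqrt B\<rfloor>. \<Sum>c\<in>coprime_pairs n.
       \<Sum>m=1..nat \<lfloor>sqrt B / real n\<rfloor>. \<Sum>b\<in>coprime_pairs m.
         B / (real m * real n)\<^sup>2 * tot_ratio (snd b * snd c))
     - ?E0 * ?E2 / 2 * (B * (ln B)\<^sup>2)\<bar> \<le> K * (B * (1 + ln B))"
      using main_eq unfolding Y_def by simp
  qed
qed

lemma torsor_count_asymptotic:
  "\<exists>C\<ge>0. \<forall>B\<ge>1. \<bar>real (torsor_count B) -
     (\<Prod>p. if prime p then euler_factor p else 1) / 2 * (B * (ln B)\<^sup>2)\<bar> \<le> C * (B * (1 + ln B))"
proof -
  obtain C1 where 1: "C1 \<ge> 0 \<and> (\<forall>B\<ge>1. \<bar>real (torsor_count B) -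
      (\<Sum>n=1..nat \<lfloor>sqrt B\<rfloor>. \<Sum>c\<in>coprime_pairs n.
       \<Sum>m=1..nat \<lfloor>sqrt B / real n\<rfloor>. \<Sum>b\<in>coprime_pairs m.
         B / (real m * real n)\<^sup>2 * tot_ratio (snd b * snd c))\<bar> \<le> C1 * (B * (1 + ln B)))"
    using torsor_count_fibre_error ..
  obtain C2 where 2: "C2 \<ge> 0 \<and> (\<forall>B\<ge>1. \<bar>(\<Sum>n=1..nat \<lfloor>sqrt B\<rfloor>. \<Sum>c\<in>coprime_pairs n.
       \<Sum>m=1..nat \<lfloor>sqrt B / real n\<rfloor>. \<Sum>b\<in>coprime_pairs m.
         B / (real m * real n)\<^sup>2 * tot_ratio (snd b * snd c))
     - pair_density (\<lambda>p. 1 / real p) * pair_density avg_weight / 2 * (B * (ln B)\<^sup>2)\<bar> \<le> C2 * (B * (1 + ln B)))"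
    using torsor_count_main_term ..
  show ?thesis
  proof (intro exI[of _ "C1 + C2"] conjI allI impI)
    fix B :: real assume "B \<ge> 1"
    from 1[THEN conjunct2, rule_format, OF this] 2[THEN conjunct2, rule_format, OF this] show "\<bar>real (torsor_count B) -
     (\<Prod>p. if prime p then euler_factor p else 1) / 2 * (B * (ln B)\<^sup>2)\<bar> \<le> (C1 + C2) * (B * (1 + ln B))"
      unfolding pair_density_mult_eq_prodinf distrib_right by linarith
  qed (use 1 2 in auto)
qed

section \<open>Parametrisation of the points\<close>

lemma homog_iff_abs_p1:
  assumes "x \<noteq> 0 \<or> y \<noteq> 0"
  shows "homog P x y \<longleftrightarrow> P = abs_p1 (x, y)"
  using homog_abs_p1[OF assms] homog_unique by metis

lemma homog_nonzero: "homog P x y \<Longrightarrow> x \<noteq> 0 \<or> y \<noteq> 0"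
  by transfer (auto simp: proj_rel_def)

lemma homog_nonzero_iff:
  assumes "homog P x y" "homog P x' y'"
  shows "x = 0 \<longleftrightarrow> x' = 0" "y = 0 \<longleftrightarrow> y' = 0"
proof -
  have "proj_rel (x, y) (x', y')"
    using assms part_equivp_proj_rel
    by transfer (meson part_equivp_symp part_equivp_transp)
  then show "x = 0 \<longleftrightarrow> x' = 0" "y = 0 \<longleftrightarrow> y' = 0"
    by (auto simp: proj_rel_def)
qed

lemma homog_minus: "homog P x y \<Longrightarrow> homog P (- x) (- y)"
proof -
  assume h: "homog P x y"
  have "proj_rel (x, y) (- x, - y)" using homog_nonzero[OF h]
    by (auto simp: proj_rel_def intro: exI[of _ "-1"])
  then have "abs_p1 (x, y) = abs_p1 (- x, - y)"
    using Quotient3_p1 part_equivp_proj_rel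
    by (metis Quotient3_rel Quotient3_p1)
  then show ?thesis
    using h homog_nonzero[OF h] by (simp add: homog_iff_abs_p1)
qed

text \<open>Avoiding the boundary modulo every prime means that no prime divides \<open>a0\<close>,
  which makes it a unit, and that none divides both \<open>a1\<close> and \<open>b1\<close> or both
  \<open>a1\<close> and \<open>c1\<close>. The torus condition supplies nonvanishing, which does not
  depend on the representative.\<close>

lemma S_points_eq: "S_points = U_integral \<inter> torus"
proof (intro equalityI subsetI IntI)
  fix P assume "P \<in> S_points"
  then obtain a0 a1 b0 b1 c0 c1 where r: "S_repr P a0 a1 b0 b1 c0 c1"
    by (auto simp: S_points_def)
  show "P \<in> torus"
    using r unfolding torus_def S_repr_def repr_def
    by (intro CollectI exI[of _ "of_int a0"] exI[of _ "of_int a1"] exI[of _ "of_int b0"]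
        exI[of _ "of_int b1"] exI[of _ "of_int c0"] exI[of _ "of_int c1"]) simp
  have "\<not> boundary_fibre p a0 a1 b0 b1 c0 c1" if p: "p = 0 \<or> prime p" for p
  proof -
    \<comment> \<open>The generic fibre \<open>p = 0\<close> is treated along with the primes: 0 is
      not a unit either, and congruence to 0 modulo 0 is divisibility by 0.\<close>
    have nu: "\<not> is_unit p" using p by auto
    have co: "coprime a1 b1" "coprime a1 c1" using r by (auto simp: S_repr_def)
    have "\<not> p dvd a0" using r nu by (auto simp: S_repr_def)
    moreover have "\<not> (p dvd a1 \<and> p dvd b1)" "\<not> (p dvd a1 \<and> p dvd c1)"
      using co[THEN coprime_common_divisor] nu by blast+
    ultimately show ?thesis by (auto simp: boundary_fibre_def cong_0_iff)
  qed
  moreover have "repr P a0 a1 b0 b1 c0 c1" "coprime a0 a1" "coprime b0 b1" "coprime c0 c1"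
    using r by (auto simp: S_repr_def)
  ultimately show "P \<in> U_integral" unfolding U_integral_def by blast
next
  fix P assume "P \<in> U_integral \<inter> torus"
  then obtain a0 a1 b0 b1 c0 c1 where r: "repr P a0 a1 b0 b1 c0 c1"
    and co: "coprime b0 b1" "coprime c0 c1"
    and nb: "\<forall>p. p = 0 \<or> prime p \<longrightarrow> \<not> boundary_fibre p a0 a1 b0 b1 c0 c1"
    and t: "P \<in> torus"
    unfolding U_integral_def by blast
  have dvd: "\<not> p dvd a0" "\<not> (p dvd a1 \<and> p dvd b1)" "\<not> (p dvd a1 \<and> p dvd c1)" if "prime p" for p
    using nb[rule_format, of p] that by (auto simp: boundary_fibre_def cong_0_iff)
  have nz: "a0 \<noteq> 0" "a1 \<noteq> 0" "b0 \<noteq> 0" "b1 \<noteq> 0" "c0 \<noteq> 0" "c1 \<noteq> 0"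
  proof -
    obtain x0 x1 y0 y1 z0 z1 where h: "homog (fst P) x0 x1" "homog (fst (snd P)) y0 y1"
      "homog (snd (snd P)) z0 z1" and n: "x0 \<noteq> 0" "x1 \<noteq> 0" "y0 \<noteq> 0" "y1 \<noteq> 0" "z0 \<noteq> 0" "z1 \<noteq> 0"
      using t by (auto simp: torus_def)
    have h': "homog (fst P) (of_int a0) (of_int a1)" "homog (fst (snd P)) (of_int b0) (of_int b1)"
      "homog (snd (snd P)) (of_int c0) (of_int c1)" using r by (auto simp: repr_def)
    show "a0 \<noteq> 0" "a1 \<noteq> 0" "b0 \<noteq> 0" "b1 \<noteq> 0" "c0 \<noteq> 0" "c1 \<noteq> 0"
      using homog_nonzero_iff[OF h(1) h'(1)] homog_nonzero_iff[OF h(2) h'(2)]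
        homog_nonzero_iff[OF h(3) h'(3)] n by auto
  qed
  have "is_unit a0" using dvd(1) prime_divisor_exists[of a0] nz by blast
  then have "a0 \<in> {1, -1}" by auto
  moreover have "coprime a1 y" if "\<And>p. prime p \<Longrightarrow> \<not> (p dvd a1 \<and> p dvd y)" for y
  proof (rule ccontr)
    assume "\<not> coprime a1 y"
    then have "\<not> is_unit (gcd a1 y)" using is_unit_gcd[of a1 y] by blast
    then obtain p where "prime p" "p dvd gcd a1 y"
      using prime_divisor_exists[of "gcd a1 y"] nz by auto
    then show False using that[of p] by auto
  qed
  from this[OF dvd(2)] this[OF dvd(3)] have "coprime a1 b1" "coprime a1 c1" by auto
  ultimately have "S_repr P a0 a1 b0 b1 c0 c1"
    using r co nz by (auto simp: S_repr_def)
  then show "P \<in> S_points" unfolding S_points_def by blast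
qed

text \<open>First coordinates are made positive, so \<open>s\<close>, \<open>t\<close>,
  \<open>u\<close> carry the signs of the second ones. The order of the tuple follows the nested
  sums of \<open>torsor_count\<close>.\<close>

definition signed_point ::
  "(int \<times> int \<times> int) \<times> nat \<times> (nat \<times> nat) \<times> nat \<times> (nat \<times> nat) \<times> nat \<Rightarrow> x0" where
  "signed_point = (\<lambda>((s, t, u), n, c, m, b, a).
     (abs_p1 (1, of_int (s * int a)),
      abs_p1 (of_nat (fst b), of_int (t * int (snd b))),
      abs_p1 (of_nat (fst c), of_int (u * int (snd c)))))"

definition torsor_points :: "real \<Rightarrow> (nat \<times> (nat \<times> nat) \<times> nat \<times> (nat \<times> nat) \<times> nat) set" where
  "torsor_points B =
     (SIGMA n:{1..nat \<lfloor>sqrt B\<rfloor>}. SIGMA c:coprime_pairs n. SIGMA m:{1..nat \<lfloor>sqrt B / real n\<rfloor>}.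
      SIGMA b:coprime_pairs m. {a\<in>{1..nat \<lfloor>B / (real m * real n)\<^sup>2\<rfloor>}. coprime a (snd b * snd c)})"

lemma finite_coprime_pairs [simp]: "finite (coprime_pairs m)"
  by (rule finite_subset[of _ "{..m} \<times> {..m}"]) (auto simp: coprime_pairs_def)

lemma card_torsor_points: "card (torsor_points B) = torsor_count B"
  unfolding torsor_points_def torsor_count_def by (simp add: card_SigmaI)

lemma S_repr_signed_point:
  assumes "s \<in> {1, -1}" "t \<in> {1, -1}" "u \<in> {1, -1}" "a > 0"
    and "b \<in> coprime_pairs m" "c \<in> coprime_pairs n" "coprime a (snd b * snd c)"
  shows "S_repr (signed_point ((s, t, u), n, c, m, b, a)) 1 (s * int a)
    (int (fst b)) (t * int (snd b)) (int (fst c)) (u * int (snd c))"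
proof -
  have sgn: "gcd x (v * y) = gcd x y" "gcd (v * x) y = gcd x y" if "v \<in> {1, -1}" for v x y :: int
    using that by auto
  have "gcd (int a) (int (snd b)) = 1" "gcd (int a) (int (snd c)) = 1"
    "gcd (int (fst b)) (int (snd b)) = 1" "gcd (int (fst c)) (int (snd c)) = 1"
    using assms by (auto simp: coprime_pairs_def gcd_int_int_eq)
  then have "gcd (s * int a) (t * int (snd b)) = 1" "gcd (s * int a) (u * int (snd c)) = 1"
    "gcd (int (fst b)) (t * int (snd b)) = 1" "gcd (int (fst c)) (u * int (snd c)) = 1"
    using assms(1-3) by (simp_all only: sgn)
  then show ?thesis
    using assms unfolding S_repr_def repr_def signed_point_def
    by (auto simp: coprime_pairs_def intro!: homog_abs_p1)
qed

lemma height_formula_signed: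
  assumes "s \<in> {1, -1}" "t \<in> {1, -1}" "u \<in> {1, -1}"
    and "b \<in> coprime_pairs m" "c \<in> coprime_pairs n"
  shows "height_formula 1 (s * int a) (int (fst b)) (t * int (snd b)) (int (fst c)) (u * int (snd c))
    = real a * (real m * real n)\<^sup>2"
proof -
  have "max (real (fst b)) (real (snd b)) = real m" "max (real (fst c)) (real (snd c)) = real n"
    using assms by (auto simp: coprime_pairs_def of_nat_max[symmetric] simp del: of_nat_max)
  moreover have "\<bar>real_of_int (v * int x)\<bar> = real x" if "v \<in> {1, -1}" for v x
    using that by auto
  ultimately show ?thesis
    unfolding height_formula_def using assms(1-3)
    by (simp only:) (simp add: power_mult_distrib)
qed

text \<open>Each point has a unique primitive representative with positive first coordinates; the
  three signs of the second coordinates are free, and the absolute values form a tuple counted by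
  \<open>torsor_count B\<close>.\<close>

lemma N_count_eq:
  assumes B: "B \<ge> 1"
  shows "N_count B = 8 * torsor_count B"
proof -
  define Sg where "Sg = {1, -1 :: int} \<times> {1, -1 :: int} \<times> {1, -1 :: int}"
  have "bij_betw signed_point (Sg \<times> torsor_points B) {P \<in> S_points. height P \<le> B}"
  proof (rule bij_betw_imageI)
    show "inj_on signed_point (Sg \<times> torsor_points B)"
    proof (rule inj_onI)
      fix x y assume xy: "x \<in> Sg \<times> torsor_points B" "y \<in> Sg \<times> torsor_points B"
        and eq: "signed_point x = signed_point y"
      obtain s t u n c m b a where x: "x = ((s, t, u), n, c, m, b, a)" by (metis prod.collapse)
      obtain s' t' u' n' c' m' b' a' where y: "y = ((s', t', u'), n', c', m', b', a')"
        by (metis prod.collapse)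
      have X: "s \<in> {1, -1}" "t \<in> {1, -1}" "u \<in> {1, -1}" "a > 0"
        "b \<in> coprime_pairs m" "c \<in> coprime_pairs n" "coprime a (snd b * snd c)"
        using xy(1) unfolding x by (auto simp: Sg_def torsor_points_def)
      have X': "s' \<in> {1, -1}" "t' \<in> {1, -1}" "u' \<in> {1, -1}" "a' > 0"
        "b' \<in> coprime_pairs m'" "c' \<in> coprime_pairs n'" "coprime a' (snd b' * snd c')"
        using xy(2) unfolding y by (auto simp: Sg_def torsor_points_def)
      note R = S_repr_signed_point[OF X] and R' = S_repr_signed_point[OF X']
      \<comment> \<open>Proportional pairs with the same nonzero first coordinate are equal; this
        recovers the signs once the absolute values are known to agree.\<close>
      have ratio: "v * int y = v' * int y'"
        if h: "homog Q (of_int (int x)) (of_int (v * int y))" "homog Q (of_int (int x)) (of_int (v' * int y'))"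
          and pos: "x > 0" for Q x v y v' y'
      proof -
        have "proj_rel (of_int (int x), of_int (v * int y)) (of_int (int x), of_int (v' * int y'))"
          using h part_equivp_proj_rel
          by transfer (meson part_equivp_symp part_equivp_transp)
        then have "of_int (v * int y) = (of_int (v' * int y') :: rat)"
          using pos by (auto simp: proj_rel_def)
        then show ?thesis by (simp only: of_int_eq_iff)
      qed
      have Rx: "S_repr (signed_point x) 1 (s * int a) (int (fst b)) (t * int (snd b)) (int (fst c)) (u * int (snd c))"
        using R unfolding x .
      have Rx': "S_repr (signed_point x) 1 (s' * int a') (int (fst b')) (t' * int (snd b')) (int (fst c')) (u' * int (snd c'))"
        using R' unfolding eq y .
      have av: "\<bar>v * int k\<bar> = int k" if "v \<in> {1, -1}" for v k
        using that by auto
      have abs: "a = a'" "fst b = fst b'" "snd b = snd b'" "fst c = fst c'" "snd c = snd c'"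
        using S_repr_unique[OF Rx Rx'] unfolding av[OF X(1)] av[OF X(2)] av[OF X(3)]
          av[OF X'(1)] av[OF X'(2)] av[OF X'(3)] by simp_all
      have H: "homog (fst Q) (of_int (int 1)) (of_int (s * int a))"
        "homog (fst (snd Q)) (of_int (int (fst b))) (of_int (t * int (snd b)))"
        "homog (snd (snd Q)) (of_int (int (fst c))) (of_int (u * int (snd c)))"
        if "Q = signed_point x" for Q
        using Rx unfolding that S_repr_def repr_def by simp_all
      have H': "homog (fst Q) (of_int (int 1)) (of_int (s' * int a'))"
        "homog (fst (snd Q)) (of_int (int (fst b))) (of_int (t' * int (snd b')))"
        "homog (snd (snd Q)) (of_int (int (fst c))) (of_int (u' * int (snd c')))"
        if "Q = signed_point x" for Q
        using Rx' unfolding that S_repr_def repr_def abs by simp_all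
      have pos: "fst b > 0" "fst c > 0" "snd b > 0" "snd c > 0"
        using X by (auto simp: coprime_pairs_def)
      have "s * int a = s' * int a'" "t * int (snd b) = t' * int (snd b')" "u * int (snd c) = u' * int (snd c')"
        using ratio[OF H(1) H'(1)] ratio[OF H(2) H'(2)] ratio[OF H(3) H'(3)] pos by simp_all
      then have "s = s'" "t = t'" "u = u'"
        using X(4) pos unfolding abs[symmetric] by simp_all
      moreover have "b = b'" "c = c'" using abs by (auto simp: prod_eq_iff)
      moreover have "m = m'" "n = n'" using X X' \<open>b = b'\<close> \<open>c = c'\<close> by (auto simp: coprime_pairs_def)
      ultimately show "x = y" using abs unfolding x y by simp
    qed
  next
    show "signed_point ` (Sg \<times> torsor_points B) = {P \<in> S_points. height P \<le> B}"
    proof (intro equalityI subsetI)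
      fix P assume "P \<in> signed_point ` (Sg \<times> torsor_points B)"
      then obtain s t u n c m b a where P: "P = signed_point ((s, t, u), n, c, m, b, a)"
        and in1: "(s, t, u) \<in> Sg" and in2: "(n, c, m, b, a) \<in> torsor_points B"
        by (auto simp: image_iff)
      have X: "s \<in> {1, -1}" "t \<in> {1, -1}" "u \<in> {1, -1}" "a > 0"
        "b \<in> coprime_pairs m" "c \<in> coprime_pairs n" "coprime a (snd b * snd c)"
        using in1 in2 by (auto simp: Sg_def torsor_points_def)
      note R = S_repr_signed_point[OF X]
      have h: "height P = real a * (real m * real n)\<^sup>2"
        unfolding P height_eq[OF R] by (rule height_formula_signed[OF X(1-3,5,6)])
      have mn: "m > 0" "n > 0" and "a \<in> {1..nat \<lfloor>B / (real m * real n)\<^sup>2\<rfloor>}"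
        using in2 by (auto simp: torsor_points_def)
      then have "real a \<le> B / (real m * real n)\<^sup>2" using le_nat_floorD by blast
      then have "height P \<le> B" unfolding h using mn by (simp add: pos_le_divide_eq)
      moreover have "P \<in> S_points" using R unfolding S_points_def P by blast
      ultimately show "P \<in> {P \<in> S_points. height P \<le> B}" by simp
    next
      fix P assume "P \<in> {P \<in> S_points. height P \<le> B}"
      then obtain a0 a1 b0 b1 c0 c1 where r: "S_repr P a0 a1 b0 b1 c0 c1" and hB: "height P \<le> B"
        by (auto simp: S_points_def)
      \<comment> \<open>Multiplying a pair by the sign of its first coordinate makes that coordinate
        positive; \<open>v\<close> is then the product of both signs.\<close>
      have sgns: "\<exists>x v y. v \<in> {1, -1} \<and> x > 0 \<and> y > 0 \<and> nat \<bar>p\<bar> = x \<and> nat \<bar>q\<bar> = y \<and>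
          Q = abs_p1 (of_nat x, of_int (v * int y))"
        if h: "homog Q (of_int p) (of_int q)" and nz: "p \<noteq> 0" "q \<noteq> 0" for Q p q
      proof -
        have h2: "homog Q (of_int \<bar>p\<bar>) (of_int (sgn p * q))"
          using h homog_minus[OF h] nz by (cases "p > 0") auto
        have eq: "sgn p * q = (sgn p * sgn q) * int (nat \<bar>q\<bar>)"
          by (simp add: mult.assoc sgn_mult_abs)
        have "Q = abs_p1 (of_int \<bar>p\<bar>, of_int (sgn p * q))"
          using h2 nz homog_iff_abs_p1[of "of_int \<bar>p\<bar>" "of_int (sgn p * q)" Q] by auto
        then have Q: "Q = abs_p1 (of_nat (nat \<bar>p\<bar>), of_int ((sgn p * sgn q) * int (nat \<bar>q\<bar>)))"
          unfolding eq by simp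
        show ?thesis
          by (rule exI[of _ "nat \<bar>p\<bar>"], rule exI[of _ "sgn p * sgn q"], rule exI[of _ "nat \<bar>q\<bar>"])
            (use Q nz in \<open>auto simp: sgn_if\<close>)
      qed
      have h: "homog (fst P) (of_int a0) (of_int a1)" "homog (fst (snd P)) (of_int b0) (of_int b1)"
        "homog (snd (snd P)) (of_int c0) (of_int c1)"
        and nz: "a0 \<noteq> 0" "a1 \<noteq> 0" "b0 \<noteq> 0" "b1 \<noteq> 0" "c0 \<noteq> 0" "c1 \<noteq> 0"
        using r by (auto simp: S_repr_def repr_def)
      obtain x s a where A: "s \<in> {1, -1}" "a > 0" "nat \<bar>a0\<bar> = x" "nat \<bar>a1\<bar> = a"
          "fst P = abs_p1 (of_nat x, of_int (s * int a))"
        using sgns[OF h(1) nz(1,2)] by blast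
      obtain x1 t y1 where Bq: "t \<in> {1, -1}" "x1 > 0" "y1 > 0" "nat \<bar>b0\<bar> = x1" "nat \<bar>b1\<bar> = y1"
          "fst (snd P) = abs_p1 (of_nat x1, of_int (t * int y1))"
        using sgns[OF h(2) nz(3,4)] by blast
      obtain x2 u y2 where Cq: "u \<in> {1, -1}" "x2 > 0" "y2 > 0" "nat \<bar>c0\<bar> = x2" "nat \<bar>c1\<bar> = y2"
          "snd (snd P) = abs_p1 (of_nat x2, of_int (u * int y2))"
        using sgns[OF h(3) nz(5,6)] by blast
      define m n where "m = max x1 y1" and "n = max x2 y2"
      have x1: "x = 1" using A(3) r by (auto simp: S_repr_def)
      have P: "P = signed_point ((s, t, u), n, (x2, y2), m, (x1, y1), a)"
        using A(5) Bq(6) Cq(6) unfolding x1 signed_point_def by (simp add: prod_eq_iff)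
      have gn: "coprime (nat \<bar>p\<bar>) (nat \<bar>q\<bar>)" if "gcd p q = 1" for p q :: int
        using that by (metis coprime_iff_gcd_eq_1 coprime_int_iff coprime_abs_left_iff coprime_abs_right_iff int_nat_eq abs_ge_zero)
      have co: "coprime a y1" "coprime a y2" "coprime x1 y1" "coprime x2 y2"
      proof -
        have "gcd a1 b1 = 1" "gcd a1 c1 = 1" "gcd b0 b1 = 1" "gcd c0 c1 = 1"
          using r by (simp_all only: S_repr_def)
        from this[THEN gn] show "coprime a y1" "coprime a y2" "coprime x1 y1" "coprime x2 y2"
          unfolding A(4) Bq(4,5) Cq(4,5) by auto
      qed
      have cp: "(x1, y1) \<in> coprime_pairs m" "(x2, y2) \<in> coprime_pairs n"
        using co Bq(2,3) Cq(2,3) by (auto simp: coprime_pairs_def m_def n_def)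
      have X: "coprime a (snd (x1, y1) * snd (x2, y2))" using co by simp
      note R = S_repr_signed_point[OF A(1) Bq(1) Cq(1) A(2) cp X]
      have ht: "height P = real a * (real m * real n)\<^sup>2"
        unfolding P height_eq[OF R] by (rule height_formula_signed[OF A(1) Bq(1) Cq(1) cp])
      have mn: "m > 0" "n > 0" using Bq(2) Cq(2) by (auto simp: m_def n_def)
      have le: "real a * (real m * real n)\<^sup>2 \<le> B" using hB ht by simp
      then have aB: "real a \<le> B / (real m * real n)\<^sup>2" using mn by (simp add: pos_le_divide_eq)
      \<comment> \<open>As \<open>a \<ge> 1\<close>, the height bound forces
        \<open>m * n \<le> sqrt B\<close>, and \<open>m \<ge> 1\<close> then bounds
        \<open>n\<close>: these are the outer ranges of \<open>torsor_points\<close>.\<close>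
      have "1 * (real m * real n)\<^sup>2 \<le> real a * (real m * real n)\<^sup>2"
        using A(2) by (intro mult_right_mono) auto
      then have "(real m * real n)\<^sup>2 \<le> B" using le by simp
      then have mnB: "real m * real n \<le> sqrt B" by (simp add: real_le_rsqrt)
      then have mB: "real m \<le> sqrt B / real n" using mn by (simp add: pos_le_divide_eq)
      have "1 * real n \<le> real m * real n" using mn by (intro mult_right_mono) auto
      then have nB: "real n \<le> sqrt B" using mnB by simp
      have "(n, (x2, y2), m, (x1, y1), a) \<in> torsor_points B"
        unfolding torsor_points_def using mn A(2) cp X aB mB nB
        by (auto simp: le_nat_floor Suc_le_eq)
      moreover have "(s, t, u) \<in> Sg" using A(1) Bq(1) Cq(1) unfolding Sg_def by blast
      ultimately show "P \<in> signed_point ` (Sg \<times> torsor_points B)" unfolding P by blast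
    qed
  qed
  from bij_betw_same_card[OF this] have "N_count B = card (Sg \<times> torsor_points B)"
    unfolding N_count_def by (rule sym)
  also have "\<dots> = 8 * torsor_count B"
    by (simp add: card_cartesian_product card_torsor_points Sg_def)
  finally show ?thesis .
qed

theorem theorem1p1:
  "S_points = U_integral \<inter> torus \<and>
   (\<lambda>B::real. real (N_count B) -
      4 * (\<Prod>p. if prime p then euler_factor p else 1) * B * (ln B)\<^sup>2)
     \<in> O[at_top](\<lambda>B. B * ln B * (ln (ln B)) ^ 3)"
proof
  show "S_points = U_integral \<inter> torus" by (rule S_points_eq)
  let ?E = "\<Prod>p. if prime p then euler_factor p else 1 :: real"
  obtain C where C: "C \<ge> 0 \<and> (\<forall>B\<ge>1. \<bar>real (torsor_count B) - ?E / 2 * (B * (ln B)\<^sup>2)\<bar> \<le> C * (B * (1 + ln B)))"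
    using torsor_count_asymptotic ..
  have "(\<lambda>B::real. real (N_count B) - 4 * ?E * B * (ln B)\<^sup>2) \<in> O[at_top](\<lambda>B. B * (1 + ln B))"
  proof (rule bigoI)
    show "\<forall>\<^sub>F B in at_top. norm (real (N_count B) - 4 * ?E * B * (ln B)\<^sup>2) \<le> 8 * C * norm (B * (1 + ln B))"
      using eventually_ge_at_top[of "1::real"]
    proof eventually_elim
      case (elim B)
      \<comment> \<open>The eight sign choices times the factor 1/2 of the torsor count give the 4
        in the constant.\<close>
      have "real (N_count B) - 4 * ?E * B * (ln B)\<^sup>2 =
          8 * (real (torsor_count B) - ?E / 2 * (B * (ln B)\<^sup>2))"
        by (simp add: N_count_eq[OF elim])
      then have "norm (real (N_count B) - 4 * ?E * B * (ln B)\<^sup>2) =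
          8 * \<bar>real (torsor_count B) - ?E / 2 * (B * (ln B)\<^sup>2)\<bar>"
        by (simp only: real_norm_def abs_mult)
      also have "\<dots> \<le> 8 * (C * (B * (1 + ln B)))"
        using C[THEN conjunct2, rule_format, OF elim] by simp
      also have "B * (1 + ln B) = norm (B * (1 + ln B))" using elim by simp
      finally show ?case by (simp only: mult.assoc)
    qed
  qed
  \<comment> \<open>The error obtained is \<open>O(B * ln B)\<close>, smaller than the allowed one
    because \<open>ln (ln B)\<close> tends to infinity.\<close>
  also have "(\<lambda>B::real. B * (1 + ln B)) \<in> O[at_top](\<lambda>B. B * ln B * (ln (ln B)) ^ 3)"
    by real_asymp
  finally show "(\<lambda>B::real. real (N_count B) - 4 * ?E * B * (ln B)\<^sup>2)
     \<in> O[at_top](\<lambda>B. B * ln B * (ln (ln B)) ^ 3)" .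
qed

end
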